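(* Let $\mathcal{P}_0$ be the set of distributions $P_p=\sum_{k=0}^\infty p_k\,\chi^2_{2k+1}$ on $(0,\infty)$, where $p=(p_k)_{k\in\mathbb{N}_0}$ satisfies $p_k>0$ for each $k\in\mathbb{N}_0$, $\sum_{k=0}^\infty p_k=1$ and $\sum_{k=0}^\infty k^2p_k<\infty$. Let $\kappa:\mathcal{P}_0\to\mathbb{R}$, $\kappa(P_p)=\sum_{k=0}^\infty k\,p_k$, be the mean functional. Let $X_1,X_2,\dots$ be independent and identically distributed random variables with unknown distribution $P_p\in\mathcal{P}_0$, and let $$T_n=\frac12\Bigl(\frac1n\sum_{i=1}^nX_i-1\Bigr),\quad n\in\mathbb{N}.$$ Then, for estimating $\kappa(P_p)$, the estimator sequence $(T_n)_{n=1}^\infty$ is asymptotically efficient at each $P_p\in\mathcal{P}_0$.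
   Context: $\chi_m^2$ is the central chi-squared distribution with $m$ degrees of freedom, with density $f_m(x)=\frac{x^{m/2-1}e^{-x/2}}{2^{m/2}\Gamma(m/2)}$, $x>0$. The mixing sequence $p$ is uniquely determined by $P_p$, so $\kappa$ is well defined. Asymptotic efficiency is understood in the sense of semiparametric theory (van der Vaart, Semiparametric statistics, 2002), as follows. Paths and tangent set: fix $P_p\in\mathcal{P}_0$. For a probability mass function $q=(q_k)_{k\in\mathbb{N}_0}$ with only finitely many non-zero $q_k$, put $P_q=\sum_kq_k\chi^2_{2k+1}$, and for $0\le a<\infty$ consider the path $P_{p,q;a,t}=P_p+at(P_q-P_p)$, $0\le t<\min(1,1/a)$ (with $1/0=\infty$), which lies in $\mathcal{P}_0$ and has Lebesgue density $v_{p,q;a,t}=\sum_k p_kf_{2k+1}+at\sum_k(q_k-p_k)f_{2k+1}$. Its score function is $g_{p,q;a}=\frac{\partial}{\partial t}\log v_{p,q;a,t}\big|_{t=0}=a\Bigl[\frac{\sum_kq_kf_{2k+1}}{\sum_kp_kf_{2k+1}}-1\Bigr]$; differentiability of the path means that $\int\bigl[\frac{v_{p,q;a,t}^{1/2}-v_{p,q;a,0}^{1/2}}{t}-\frac12g_{p,q;a}\,v_{p,q;a,0}^{1/2}\bigr]^2dx\to0$ as $t\downarrow0$. The tangent set $\dot{\mathcal{P}}_{P_p}\subset L_2(P_p)$ is the set of all these scores $g_{p,q;a}$ (over all $q$ with finite support and all $a\ge0$). Efficient influence function: $\kappa$ is differentiable at $P_p$ relative to $\dot{\mathcal{P}}_{P_p}$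 if there is a function $\tilde\kappa_{P_p}$ in the closed linear span of $\dot{\mathcal{P}}_{P_p}$ in $L_2(P_p)$ such that $\lim_{t\downarrow0}\frac{\kappa(P_{p,q;a,t})-\kappa(P_p)}{t}=\int\tilde\kappa_{P_p}\,g_{p,q;a}\,dP_p$ for all such $q$ and $a$; this $\tilde\kappa_{P_p}$ is then unique and is called the efficient influence function. The lower bound for the asymptotic variance is $\int\tilde\kappa_{P_p}^2\,dP_p$. Asymptotic efficiency: $(T_n)$ is asymptotically efficient at $P_p$ for $\kappa$ if $\kappa$ is differentiable at $P_p$ relative to $\dot{\mathcal{P}}_{P_p}$ and $(T_n)$ is regular at $P_p$ with limit distribution $N(0,\int\tilde\kappa_{P_p}^2\,dP_p)$. That is, for each path $t\mapsto P_{p,q;a,t}=P_p+at(P_q-P_p)$, $0\le t<\min(1,1/a)$, where $q$ is a probability mass function on $\mathbb{N}_0$ with only finitely many non-zero $q_k$ and $0\le a<\infty$, if for each (sufficiently large) $n$ the variables $X_1,\dots,X_n$ are i.i.d. with distribution $P_{p,q;a,1/\sqrt n}$, then $\sqrt n\bigl(T_n-\kappa(P_{p,q;a,1/\sqrt n})\bigr)$ converges in distribution to $N(0,\int\tilde\kappa_{P_p}^2\,dP_p)$. In particular (take $a=0$) the asymptotic variance of $T_n$ under $P_p$ equals the lower bound. *)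

theory Defs
  imports "HOL-Probability.Probability"
begin

definition chisq_density :: "nat \<Rightarrow> real \<Rightarrow> real" where
  "chisq_density m x =
     (if 0 < x
      then x powr (real m / 2 - 1) * exp (- x / 2) / (2 powr (real m / 2) * Gamma (real m / 2))
      else 0)"

definition chisq :: "nat \<Rightarrow> real measure" where
  "chisq m = density lborel (\<lambda>x. ennreal (chisq_density m x))"

text \<open>The distributions on \<open>(0,\<infinity>)\<close> are represented as Borel measures on the real line.\<close>

definition chisq_mix :: "(nat \<Rightarrow> real) \<Rightarrow> real measure" where
  "chisq_mix p =
     measure_of UNIV (sets borel) (\<lambda>A. \<Sum>k. ennreal (p k) * emeasure (chisq (2 * k + 1)) A)"

definition mixing_seq :: "(nat \<Rightarrow> real) \<Rightarrow> bool" where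
  "mixing_seq p \<longleftrightarrow> (\<forall>k. 0 < p k) \<and> p sums 1 \<and> summable (\<lambda>k. (real k)\<^sup>2 * p k)"

text \<open>The mixing sequence is unique, see \<open>chisq_mix_inject\<close> below.\<close>

definition mixing_of :: "real measure \<Rightarrow> nat \<Rightarrow> real" where
  "mixing_of P = (THE p. mixing_seq p \<and> P = chisq_mix p)"

definition kappa :: "real measure \<Rightarrow> real" where
  "kappa P = (\<Sum>k. real k * mixing_of P k)"

definition mean_estimator :: "nat \<Rightarrow> (nat \<Rightarrow> real) \<Rightarrow> real" where
  "mean_estimator n x = 1 / 2 * (1 / real n * (\<Sum>i = 1..n. x i) - 1)"

definition finite_pmf :: "(nat \<Rightarrow> real) \<Rightarrow> bool" where
  "finite_pmf q \<longleftrightarrow> (\<forall>k. 0 \<le> q k) \<and> finite {k. q k \<noteq> 0} \<and> q sums 1"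

definition mix_path :: "(nat \<Rightarrow> real) \<Rightarrow> (nat \<Rightarrow> real) \<Rightarrow> real \<Rightarrow> real \<Rightarrow> real measure" where
  "mix_path p q a t =
     measure_of UNIV (sets borel)
       (\<lambda>A. ennreal (measure (chisq_mix p) A
              + a * t * (measure (chisq_mix q) A - measure (chisq_mix p) A)))"

definition path_density ::
    "(nat \<Rightarrow> real) \<Rightarrow> (nat \<Rightarrow> real) \<Rightarrow> real \<Rightarrow> real \<Rightarrow> real \<Rightarrow> real" where
  "path_density p q a t x =
     (\<Sum>k. p k * chisq_density (2 * k + 1) x)
     + a * t * (\<Sum>k. (q k - p k) * chisq_density (2 * k + 1) x)"

text \<open>The path density is affine in \<open>t\<close>, defined for all real \<open>t\<close>, and positive at \<open>t = 0\<close> if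
  \<open>x > 0\<close>; so the two-sided derivative below exists and is the one from the right, and its closed
  form is given by \<open>score_eq\<close>. The value on the null set \<open>x \<le> 0\<close> is immaterial.\<close>

definition score :: "(nat \<Rightarrow> real) \<Rightarrow> (nat \<Rightarrow> real) \<Rightarrow> real \<Rightarrow> real \<Rightarrow> real" where
  "score p q a x = deriv (\<lambda>t. ln (path_density p q a t x)) 0"

text \<open>Differentiability in quadratic mean; it holds for all the paths considered here, see
  \<open>all_paths_differentiable\<close>.\<close>

definition differentiable_path :: "(nat \<Rightarrow> real) \<Rightarrow> (nat \<Rightarrow> real) \<Rightarrow> real \<Rightarrow> bool" where
  "differentiable_path p q a \<longleftrightarrow>
     ((\<lambda>t. \<integral>\<^sup>+ x. ennreal
              (((sqrt (path_density p q a t x) - sqrt (path_density p q a 0 x)) / t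
                - 1 / 2 * score p q a x * sqrt (path_density p q a 0 x))\<^sup>2) \<partial>lborel)
      \<longlongrightarrow> 0) (at_right 0)"

definition tangent_set :: "(nat \<Rightarrow> real) \<Rightarrow> (real \<Rightarrow> real) set" where
  "tangent_set p = {score p q a | q a. finite_pmf q \<and> 0 \<le> a}"

definition square_integrable :: "'a measure \<Rightarrow> ('a \<Rightarrow> real) \<Rightarrow> bool" where
  "square_integrable M h \<longleftrightarrow> h \<in> borel_measurable M \<and> integrable M (\<lambda>x. (h x)\<^sup>2)"

text \<open>Membership of (the class of) \<open>h\<close> in the closure, in \<open>L\<^sub>2(M)\<close>, of the finite linear
  combinations of elements of \<open>S\<close>; \<open>S\<close> is meant to consist of square-integrable functions.\<close>

definition in_closed_span :: "'a measure \<Rightarrow> ('a \<Rightarrow> real) set \<Rightarrow> ('a \<Rightarrow> real) \<Rightarrow> bool" where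
  "in_closed_span M S h \<longleftrightarrow>
     square_integrable M h \<and>
     (\<forall>\<epsilon>>0. \<exists>(N::nat) c g. (\<forall>i<N. g i \<in> S) \<and>
        (\<integral>\<^sup>+ x. ennreal ((h x - (\<Sum>i<N. c i * g i x))\<^sup>2) \<partial>M) < ennreal \<epsilon>)"

definition efficient_influence ::
    "(real measure \<Rightarrow> real) \<Rightarrow> (nat \<Rightarrow> real) \<Rightarrow> (real \<Rightarrow> real) \<Rightarrow> bool" where
  "efficient_influence \<phi> p h \<longleftrightarrow>
     in_closed_span (chisq_mix p) (tangent_set p) h \<and>
     (\<forall>q a. finite_pmf q \<longrightarrow> 0 \<le> a \<longrightarrow>
        ((\<lambda>t. (\<phi> (mix_path p q a t) - \<phi> (chisq_mix p)) / t)
          \<longlongrightarrow> (\<integral>x. h x * score p q a x \<partial>chisq_mix p)) (at_right 0))"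

text \<open>The centred normal law with variance \<open>v\<close>, including the degenerate case.\<close>

definition centred_normal :: "real \<Rightarrow> real measure" where
  "centred_normal v =
     (if v = 0 then return borel 0
      else density lborel (\<lambda>x. ennreal (normal_density 0 (sqrt v) x)))"

text \<open>For every \<open>n\<close>, the sample \<open>X n 1, \<dots>, X n n\<close> may live on its own probability space
  \<open>M n\<close>. The type \<open>'w\<close> of outcomes is a parameter, since a definition cannot quantify over
  types.\<close>

definition regular_with_limit ::
    "'w itself \<Rightarrow> (real measure \<Rightarrow> real) \<Rightarrow> (nat \<Rightarrow> real)
       \<Rightarrow> (nat \<Rightarrow> (nat \<Rightarrow> real) \<Rightarrow> real) \<Rightarrow> real measure \<Rightarrow> bool" where
  "regular_with_limit _ \<phi> p T L \<longleftrightarrow>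
     (\<forall>q a. finite_pmf q \<longrightarrow> 0 \<le> a \<longrightarrow>
       (\<forall>(M :: nat \<Rightarrow> 'w measure) (X :: nat \<Rightarrow> nat \<Rightarrow> 'w \<Rightarrow> real).
          (\<forall>n. prob_space (M n)) \<longrightarrow>
          (\<forall>\<^sub>F n in sequentially.
             prob_space.indep_vars (M n) (\<lambda>_. borel) (X n) {1..n} \<and>
             (\<forall>i\<in>{1..n}. distr (M n) borel (X n i) = mix_path p q a (1 / sqrt (real n)))) \<longrightarrow>
          weak_conv_m
            (\<lambda>n. distr (M n) borel
               (\<lambda>\<omega>. sqrt (real n) *
                  (T n (\<lambda>i. X n i \<omega>) - \<phi> (mix_path p q a (1 / sqrt (real n))))))
            L))"

definition asymptotically_efficient ::
    "'w itself \<Rightarrow> (real measure \<Rightarrow> real) \<Rightarrow> (nat \<Rightarrow> real)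
       \<Rightarrow> (nat \<Rightarrow> (nat \<Rightarrow> real) \<Rightarrow> real) \<Rightarrow> bool" where
  "asymptotically_efficient w \<phi> p T \<longleftrightarrow>
     (\<exists>h. efficient_influence \<phi> p h \<and>
          regular_with_limit w \<phi> p T (centred_normal (\<integral>x. (h x)\<^sup>2 \<partial>chisq_mix p)))"

definition chisq_coeff :: "nat \<Rightarrow> real" where
  "chisq_coeff k = 1 / (2 powr (real k + 1 / 2) * Gamma (real k + 1 / 2))"

lemma chisq_coeff_pos: "0 < chisq_coeff k"
  by (auto simp: chisq_coeff_def intro!: mult_pos_pos Gamma_real_pos)

lemma chisq_coeff_le: "chisq_coeff k \<le> chisq_coeff 0 / fact k"
proof (induction k)
  case (Suc k)
  have G: "Gamma (real k + 1 / 2 + 1) = (real k + 1 / 2) * Gamma (real k + 1 / 2)"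
    by (rule Gamma_plus1) (auto elim!: nonpos_Ints_cases)
  have "2 powr (real (Suc k) + 1 / 2) = 2 * 2 powr (real k + 1 / 2)"
    by (simp only: of_nat_Suc add.assoc[symmetric] powr_add) (simp add: add.commute)
  moreover have "Gamma (real (Suc k) + 1 / 2) = (real k + 1 / 2) * Gamma (real k + 1 / 2)"
    using G by (simp add: algebra_simps)
  ultimately have "chisq_coeff (Suc k)
      = 1 / ((2 * 2 powr (real k + 1 / 2)) * ((real k + 1 / 2) * Gamma (real k + 1 / 2)))"
    by (simp only: chisq_coeff_def)
  also have "\<dots> = chisq_coeff k / (2 * real k + 1)"
    unfolding chisq_coeff_def by (simp add: divide_simps)
  also have "\<dots> \<le> chisq_coeff k / (real k + 1)"
    using chisq_coeff_pos[of k] by (intro divide_left_mono) auto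
  also have "\<dots> \<le> (chisq_coeff 0 / fact k) / (real k + 1)"
    by (intro divide_right_mono Suc.IH) auto
  also have "\<dots> = chisq_coeff 0 / fact (Suc k)"
    by (simp add: field_simps)
  finally show ?case .
qed simp

lemma chisq_density_odd:
  assumes "0 < x"
  shows "chisq_density (2 * k + 1) x = x powr (- 1 / 2) * exp (- x / 2) * (chisq_coeff k * x ^ k)"
proof -
  have "real (2 * k + 1) / 2 - 1 = - 1 / 2 + real k" "real (2 * k + 1) / 2 = real k + 1 / 2"
    by (simp_all add: field_simps)
  then show ?thesis
    using assms unfolding chisq_density_def chisq_coeff_def
    by (simp only: powr_add) (simp add: powr_realpow)
qed

lemma chisq_density_nonneg: "0 \<le> chisq_density m x"
  by (cases "m = 0")
     (auto simp: chisq_density_def Gamma_real_pos less_imp_le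
       intro!: divide_nonneg_nonneg mult_nonneg_nonneg)

lemma chisq_density_nonpos [simp]: "x \<le> 0 \<Longrightarrow> chisq_density m x = 0"
  by (simp add: chisq_density_def)

lemma chisq_density_measurable [measurable]: "chisq_density m \<in> borel_measurable borel"
  unfolding chisq_density_def[abs_def] by measurable

lemma prob_space_chisq:
  assumes "0 < m"
  shows "prob_space (chisq m)"
proof -
  let ?s = "real m / 2"
  have s: "0 < ?s" using assms by simp
  then have G: "0 < Gamma ?s" by (rule Gamma_real_pos)
  have *: "ennreal 2 * ennreal (chisq_density m (0 + 2 * t))
        = ennreal (1 / Gamma ?s) * ennreal (indicator {0..} t * t powr (?s - 1) / exp t)"
    if "t \<noteq> 0" for t
  proof (cases "0 < t")
    case True
    have "2 * chisq_density m (2 * t) = 1 / Gamma ?s * (t powr (?s - 1) / exp t)"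
      using True G unfolding chisq_density_def
      by (simp only: powr_mult powr_diff) (simp add: exp_minus field_simps)
    then have "ennreal 2 * ennreal (chisq_density m (2 * t))
        = ennreal (1 / Gamma ?s) * ennreal (t powr (?s - 1) / exp t)"
      using G True by (simp only: ennreal_mult'[symmetric] ennreal_mult''[symmetric]
        chisq_density_nonneg divide_nonneg_pos less_imp_le powr_ge_zero exp_gt_zero zero_le_numeral
        zero_le_one zero_le_divide_1_iff)
    then show ?thesis
      using True by simp
  qed (use that in simp)
  have "emeasure (chisq m) UNIV = (\<integral>\<^sup>+x. ennreal (chisq_density m x) \<partial>lborel)"
    unfolding chisq_def by (subst emeasure_density) auto
  also have "\<dots> = ennreal 2 * (\<integral>\<^sup>+t. ennreal (chisq_density m (0 + 2 * t)) \<partial>lborel)"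
    by (subst nn_integral_real_affine[where c = 2 and t = 0]) auto
  also have "\<dots> = (\<integral>\<^sup>+t. ennreal 2 * ennreal (chisq_density m (0 + 2 * t)) \<partial>lborel)"
    by (subst nn_integral_cmult) auto
  also have "\<dots> = (\<integral>\<^sup>+t. ennreal (1 / Gamma ?s)
                     * ennreal (indicator {0..} t * t powr (?s - 1) / exp t) \<partial>lborel)"
    by (intro nn_integral_cong_AE) (use AE_lborel_singleton[of 0] * in auto)
  also have "\<dots> = ennreal (1 / Gamma ?s) * ennreal (Gamma ?s)"
    using Gamma_conv_nn_integral_real[OF s] by (subst nn_integral_cmult) auto
  also have "\<dots> = 1"
    using G by (simp flip: ennreal_mult')
  finally show ?thesis
    by (intro prob_spaceI) (simp add: chisq_def)
qed

lemma summable_coeff_power: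
  assumes "Bseq r"
  shows "summable (\<lambda>k. r k * chisq_coeff k * x ^ k)"
proof -
  obtain K where K: "\<And>k. norm (r k) \<le> K" "0 < K"
    using assms by (auto simp: Bseq_def)
  have "norm (r k * chisq_coeff k * x ^ k) \<le> K * chisq_coeff 0 * (inverse (fact k) * \<bar>x\<bar> ^ k)" for k
  proof -
    have "norm (r k * chisq_coeff k * x ^ k) = norm (r k) * (chisq_coeff k * \<bar>x\<bar> ^ k)"
      using chisq_coeff_pos[of k] by (simp add: abs_mult power_abs)
    also have "\<dots> \<le> K * ((chisq_coeff 0 / fact k) * \<bar>x\<bar> ^ k)"
      using K chisq_coeff_pos[of k] chisq_coeff_le[of k]
      by (intro mult_mono mult_nonneg_nonneg) auto
    finally show ?thesis by (simp add: field_simps)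
  qed
  then show ?thesis
    by (intro summable_comparison_test'[where N = 0,
          OF summable_mult[OF summable_exp[of "\<bar>x\<bar>"]]]) auto
qed

lemma summable_chisq_density:
  assumes "Bseq r"
  shows "summable (\<lambda>k. r k * chisq_density (2 * k + 1) x)"
proof (cases "0 < x")
  case True
  have "(\<lambda>k. r k * chisq_density (2 * k + 1) x)
      = (\<lambda>k. x powr (- 1 / 2) * exp (- x / 2) * (r k * chisq_coeff k * x ^ k))"
    unfolding chisq_density_odd[OF True] by (simp only: mult_ac)
  then show ?thesis
    using summable_mult[OF summable_coeff_power[OF assms]] by metis
qed simp

lemma Bseq_sums: "(p :: nat \<Rightarrow> real) sums s \<Longrightarrow> Bseq p"
  using summable_imp_Bseq sums_summable by blast

lemma mixing_seq_Bseq: "mixing_seq p \<Longrightarrow> Bseq p"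
  by (auto simp: mixing_seq_def intro: Bseq_sums)

lemma finite_pmf_Bseq: "finite_pmf q \<Longrightarrow> Bseq q"
  by (auto simp: finite_pmf_def intro: Bseq_sums)

definition mix_density :: "(nat \<Rightarrow> real) \<Rightarrow> real \<Rightarrow> real" where
  "mix_density p x = (\<Sum>k. p k * chisq_density (2 * k + 1) x)"

lemma mix_density_measurable [measurable]: "mix_density p \<in> borel_measurable borel"
  unfolding mix_density_def[abs_def] by measurable

lemma mix_density_nonneg:
  assumes "\<And>k. 0 \<le> p k" "Bseq p"
  shows "0 \<le> mix_density p x"
  unfolding mix_density_def using assms
  by (intro suminf_nonneg summable_chisq_density) (auto simp: chisq_density_nonneg)

lemma chisq_mix_eq_density:
  assumes p: "\<And>k. 0 \<le> p k" "Bseq p"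
  shows "chisq_mix p = density lborel (\<lambda>x. ennreal (mix_density p x))"
proof -
  let ?D = "density lborel (\<lambda>x. ennreal (mix_density p x))"
  have "emeasure ?D A = (\<Sum>k. ennreal (p k) * emeasure (chisq (2 * k + 1)) A)"
    if A: "A \<in> sets borel" for A
  proof -
    have [measurable]: "A \<in> sets borel" by fact
    have "emeasure ?D A = (\<integral>\<^sup>+x. ennreal (mix_density p x) * indicator A x \<partial>lborel)"
      by (subst emeasure_density) auto
    also have "\<dots> = (\<integral>\<^sup>+x. (\<Sum>k. ennreal (p k) * (ennreal (chisq_density (2 * k + 1) x) * indicator A x)) \<partial>lborel)"
    proof (intro nn_integral_cong)
      fix x :: real
      have "ennreal (mix_density p x) = (\<Sum>k. ennreal (p k * chisq_density (2 * k + 1) x))"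
        unfolding mix_density_def using p
        by (intro suminf_ennreal2[symmetric] summable_chisq_density) (auto simp: chisq_density_nonneg)
      also have "\<dots> = (\<Sum>k. ennreal (p k) * ennreal (chisq_density (2 * k + 1) x))"
        using p by (intro suminf_cong) (auto simp: ennreal_mult chisq_density_nonneg)
      finally show "ennreal (mix_density p x) * indicator A x
          = (\<Sum>k. ennreal (p k) * (ennreal (chisq_density (2 * k + 1) x) * indicator A x))"
        by (simp add: ennreal_suminf_multc flip: mult.assoc)
    qed
    also have "\<dots> = (\<Sum>k. \<integral>\<^sup>+x. ennreal (p k) * (ennreal (chisq_density (2 * k + 1) x) * indicator A x) \<partial>lborel)"
      by (intro nn_integral_suminf) auto
    also have "\<dots> = (\<Sum>k. ennreal (p k) * emeasure (chisq (2 * k + 1)) A)"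
      unfolding chisq_def
      by (intro suminf_cong, subst emeasure_density, simp, simp, subst nn_integral_cmult) auto
    finally show ?thesis .
  qed
  then have "chisq_mix p = measure_of UNIV (sets borel) (emeasure ?D)"
    unfolding chisq_mix_def by (intro measure_of_eq) (auto simp: sets.sigma_sets_eq[of borel, simplified])
  also have "\<dots> = ?D"
    using measure_of_of_measure[of ?D] by simp
  finally show ?thesis .
qed

lemma sets_chisq_mix [simp, measurable_cong]: "sets (chisq_mix p) = sets borel"
  unfolding chisq_mix_def using sets.sigma_sets_eq[of borel] by simp

lemma space_chisq_mix [simp]: "space (chisq_mix p) = UNIV"
  unfolding chisq_mix_def by simp

lemma prob_space_chisq_mix:
  assumes p: "\<And>k. 0 \<le> p k" "p sums 1"
  shows "prob_space (chisq_mix p)"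
proof -
  have em: "emeasure (chisq (2 * k + 1)) UNIV = 1" for k
    using prob_space.emeasure_space_1[OF prob_space_chisq[of "2 * k + 1"]] by (simp add: chisq_def)
  have "emeasure (chisq_mix p) UNIV = (\<Sum>k. ennreal (p k) * emeasure (chisq (2 * k + 1)) UNIV)"
  proof -
    have "emeasure (chisq_mix p) UNIV = (\<integral>\<^sup>+x. ennreal (mix_density p x) \<partial>lborel)"
      using p Bseq_sums by (subst chisq_mix_eq_density) (auto simp: emeasure_density)
    also have "\<dots> = (\<integral>\<^sup>+x. (\<Sum>k. ennreal (p k) * ennreal (chisq_density (2 * k + 1) x)) \<partial>lborel)"
      unfolding mix_density_def using p Bseq_sums[OF p(2)]
      by (intro nn_integral_cong, subst suminf_ennreal2[symmetric])
         (auto simp: chisq_density_nonneg ennreal_mult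
            intro: summable_chisq_density[unfolded Suc_eq_plus1[symmetric]])
    also have "\<dots> = (\<Sum>k. \<integral>\<^sup>+x. ennreal (p k) * ennreal (chisq_density (2 * k + 1) x) \<partial>lborel)"
      by (intro nn_integral_suminf) auto
    also have "\<dots> = (\<Sum>k. ennreal (p k) * emeasure (chisq (2 * k + 1)) UNIV)"
      unfolding chisq_def
      by (intro suminf_cong, subst emeasure_density, simp, simp, subst nn_integral_cmult) auto
    finally show ?thesis .
  qed
  also have "\<dots> = (\<Sum>k. ennreal (p k))" by (simp only: em mult_1_right)
  also have "\<dots> = 1"
    using p by (subst suminf_ennreal2) (auto simp: sums_iff)
  finally show ?thesis by (intro prob_spaceI) simp
qed

lemma coeff_power_unique:
  assumes "Bseq (d :: nat \<Rightarrow> real)"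
    and ae: "AE x in lborel. 0 < x \<longrightarrow> (\<Sum>k. d k * chisq_coeff k * x ^ k) = 0"
  shows "d k = 0"
proof (induction k rule: less_induct)
  case (less k)
  let ?a = "\<lambda>j. d j * chisq_coeff j"
  define G where "G = (\<lambda>x. \<Sum>j. ?a (j + k) * x ^ j)"
  have S: "summable (\<lambda>j. ?a j * x ^ j)" for x
    by (rule summable_coeff_power[OF assms(1)])
  have F: "(\<Sum>j. ?a j * x ^ j) = x ^ k * G x" if "0 < x" for x
  proof -
    have Sk: "summable (\<lambda>j. ?a (j + k) * x ^ (j + k))"
      by (rule summable_ignore_initial_segment[OF S])
    have "(\<Sum>j. ?a j * x ^ j) = (\<Sum>j. ?a (j + k) * x ^ (j + k)) + (\<Sum>j<k. ?a j * x ^ j)"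
      by (rule suminf_split_initial_segment[OF S])
    also have "(\<Sum>j<k. ?a j * x ^ j) = 0"
      using less by (intro sum.neutral) auto
    also have "(\<Sum>j. ?a (j + k) * x ^ (j + k)) = (\<Sum>j. x ^ k * (?a (j + k) * x ^ j))"
      by (simp add: power_add mult_ac)
    also have "\<dots> = x ^ k * G x"
    proof -
      have "summable (\<lambda>j. inverse (x ^ k) * (?a (j + k) * x ^ (j + k)))"
        by (rule summable_mult[OF Sk])
      then have "summable (\<lambda>j. ?a (j + k) * x ^ j)"
        using that by (simp add: power_add field_simps)
      then show ?thesis unfolding G_def by (rule suminf_mult)
    qed
    finally show ?thesis by simp
  qed
  have cont: "isCont G 0"
    unfolding G_def
    by (rule isCont_powser[of _ 1])
       (use summable_ignore_initial_segment[OF S[of 1], of k] in auto)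
  have "G 0 = 0"
  proof (rule ccontr)
    assume "G 0 \<noteq> 0"
    then obtain s where s: "0 < s" "\<And>z. dist z 0 < s \<Longrightarrow> dist (G z) (G 0) < \<bar>G 0\<bar>"
      using cont unfolding continuous_at_eps_delta by (metis dist_real_def zero_less_abs_iff)
    have "AE x in lborel. x \<notin> {0<..<s}"
      using ae
    proof eventually_elim
      case (elim x)
      show ?case
      proof
        assume x: "x \<in> {0<..<s}"
        then have "G x = 0" using elim F[of x] by simp
        moreover have "dist (G x) (G 0) < \<bar>G 0\<bar>" using x by (intro s) (auto simp: dist_real_def)
        ultimately show False by (simp add: dist_real_def)
      qed
    qed
    then have "emeasure lborel {0<..<s} = 0"
      by (subst (asm) AE_iff_measurable[where N = "{0<..<s}"]) auto
    then show False using s by simp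
  qed
  moreover have "G 0 = ?a k"
    unfolding G_def using powser_zero[of "\<lambda>j. ?a (j + k)"] by simp
  ultimately show ?case using chisq_coeff_pos[of k] by simp
qed

lemma chisq_mix_inject:
  assumes "mixing_seq p" "mixing_seq p'" "chisq_mix p = chisq_mix p'"
  shows "p = p'"
proof
  fix k
  have p: "\<And>k. 0 \<le> p k" "Bseq p" "\<And>k. 0 \<le> p' k" "Bseq p'"
    using assms mixing_seq_Bseq by (auto simp: mixing_seq_def less_imp_le)
  have "AE x in lborel. ennreal (mix_density p x) = ennreal (mix_density p' x)"
    using assms(3) p
    by (intro sigma_finite_measure.density_unique[OF sigma_finite_lborel])
       (auto simp: chisq_mix_eq_density)
  then have "AE x in lborel. 0 < x \<longrightarrow> (\<Sum>k. (p k - p' k) * chisq_coeff k * x ^ k) = 0"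
  proof eventually_elim
    case (elim x)
    show ?case
    proof
      assume x: "0 < x"
      let ?w = "x powr (- 1 / 2) * exp (- x / 2)"
      have eq: "mix_density r x = ?w * (\<Sum>k. r k * chisq_coeff k * x ^ k)" if "Bseq r" for r
        unfolding mix_density_def
        by (subst suminf_mult[symmetric, OF summable_coeff_power[OF that]])
           (unfold chisq_density_odd[OF x], simp only: mult_ac)
      have "mix_density p x = mix_density p' x"
        using elim p by (simp add: mix_density_nonneg)
      then have "(\<Sum>k. p k * chisq_coeff k * x ^ k) = (\<Sum>k. p' k * chisq_coeff k * x ^ k)"
        using x by (simp add: eq p)
      then show "(\<Sum>k. (p k - p' k) * chisq_coeff k * x ^ k) = 0"
        using suminf_diff[OF summable_coeff_power[OF p(2)] summable_coeff_power[OF p(4)], of x x]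
        by (simp add: algebra_simps)
    qed
  qed
  moreover have "Bseq (\<lambda>k. p k - p' k)"
    using assms by (auto simp: mixing_seq_def intro: Bseq_sums sums_diff)
  ultimately have "p k - p' k = 0" by (intro coeff_power_unique[where d = "\<lambda>k. p k - p' k"])
  then show "p k = p' k" by simp
qed

lemma kappa_chisq_mix:
  assumes "mixing_seq p"
  shows "kappa (chisq_mix p) = (\<Sum>k. real k * p k)"
proof -
  have "mixing_of (chisq_mix p) = p"
    unfolding mixing_of_def using assms chisq_mix_inject by (intro the_equality) auto
  then show ?thesis by (simp add: kappa_def)
qed

lemma finite_pmf_summable: "finite_pmf q \<Longrightarrow> summable (\<lambda>k. c k * q k)" for c :: "nat \<Rightarrow> real"
  by (auto simp: finite_pmf_def intro!: summable_finite[of "{k. q k \<noteq> 0}"])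

lemma path_range:
  assumes "0 \<le> (a::real)" "0 \<le> t" "a * t < 1"
  shows "0 < 1 - a * t" "0 \<le> a * t"
  using assms by auto

lemma mixing_seq_path:
  assumes "mixing_seq p" "finite_pmf q" "0 \<le> a" "0 \<le> t" "a * t < 1"
  shows "mixing_seq (\<lambda>k. p k + a * t * (q k - p k))"
proof -
  have eq: "(\<lambda>k. p k + a * t * (q k - p k)) = (\<lambda>k. (1 - a * t) * p k + a * t * q k)"
    by (auto simp: algebra_simps)
  note r = path_range[OF assms(3-5)]
  have "(\<lambda>k. (1 - a * t) * p k + a * t * q k) sums ((1 - a * t) * 1 + a * t * 1)"
    using assms by (intro sums_add sums_mult) (auto simp: mixing_seq_def finite_pmf_def)
  moreover have "summable (\<lambda>k. (1 - a * t) * ((real k)\<^sup>2 * p k) + a * t * ((real k)\<^sup>2 * q k))"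
    using assms finite_pmf_summable[of q "\<lambda>k. (real k)\<^sup>2"]
    by (intro summable_add summable_mult) (auto simp: mixing_seq_def)
  then have "summable (\<lambda>k. (real k)\<^sup>2 * ((1 - a * t) * p k + a * t * q k))"
    by (simp add: algebra_simps)
  moreover have "0 < (1 - a * t) * p k + a * t * q k" for k
    using assms r by (intro add_pos_nonneg mult_pos_pos mult_nonneg_nonneg)
      (auto simp: mixing_seq_def finite_pmf_def)
  ultimately show ?thesis unfolding mixing_seq_def eq by simp
qed

lemma mix_density_path:
  assumes "Bseq p" "Bseq q"
  shows "mix_density (\<lambda>k. p k + c * (q k - p k)) x
      = mix_density p x + c * (mix_density q x - mix_density p x)"
proof -
  note s = summable_chisq_density[OF assms(1), of x] summable_chisq_density[OF assms(2), of x]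
  let ?f = "\<lambda>k. chisq_density (2 * k + 1) x"
  have "(\<lambda>k. p k * ?f k + c * (q k * ?f k - p k * ?f k)) sums
          (mix_density p x + c * (mix_density q x - mix_density p x))"
    unfolding mix_density_def
    by (intro sums_add sums_mult sums_diff summable_sums s)
  then show ?thesis
    unfolding mix_density_def by (simp add: sums_iff algebra_simps)
qed

lemma path_density_eq:
  assumes "mixing_seq p" "finite_pmf q"
  shows "path_density p q a t x = mix_density p x + a * t * (mix_density q x - mix_density p x)"
proof -
  note s = summable_chisq_density[OF mixing_seq_Bseq[OF assms(1)], of x]
           summable_chisq_density[OF finite_pmf_Bseq[OF assms(2)], of x]
  show ?thesis
    unfolding path_density_def mix_density_def
    using suminf_diff[OF s(2,1)] by (simp add: algebra_simps)
qed

lemma mix_path_eq: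
  assumes "mixing_seq p" "finite_pmf q" "0 \<le> a" "0 \<le> t" "a * t < 1"
  shows "mix_path p q a t = chisq_mix (\<lambda>k. p k + a * t * (q k - p k))"
    and "mix_path p q a t = density lborel (\<lambda>x. ennreal (path_density p q a t x))"
proof -
  note r = path_range[OF assms(3-5)]
  let ?D = "density lborel (\<lambda>x. ennreal (path_density p q a t x))"
  have nn: "\<And>k. 0 \<le> p k" "\<And>k. 0 \<le> q k" and B: "Bseq p" "Bseq q"
    using assms mixing_seq_Bseq finite_pmf_Bseq by (auto simp: mixing_seq_def finite_pmf_def less_imp_le)
  have pd: "path_density p q a t = (\<lambda>x. (1 - a * t) * mix_density p x + a * t * mix_density q x)"
    using path_density_eq[OF assms(1,2)] by (auto simp: algebra_simps)
  have [measurable]: "path_density p q a t \<in> borel_measurable borel" unfolding pd by measurable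
  interpret P: prob_space "chisq_mix p"
    using assms by (intro prob_space_chisq_mix) (auto simp: mixing_seq_def less_imp_le)
  interpret Q: prob_space "chisq_mix q"
    using assms by (intro prob_space_chisq_mix) (auto simp: finite_pmf_def)
  have "emeasure ?D A = ennreal (measure (chisq_mix p) A
            + a * t * (measure (chisq_mix q) A - measure (chisq_mix p) A))"
    if A [measurable]: "A \<in> sets borel" for A
  proof -
    have "emeasure ?D A
        = (\<integral>\<^sup>+x. ennreal (1 - a * t) * (ennreal (mix_density p x) * indicator A x)
                + ennreal (a * t) * (ennreal (mix_density q x) * indicator A x) \<partial>lborel)"
    proof (subst emeasure_density)
      have "ennreal (path_density p q a t x)
          = ennreal (1 - a * t) * ennreal (mix_density p x) + ennreal (a * t) * ennreal (mix_density q x)"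
        for x
        unfolding pd using nn B r
        by (simp only: ennreal_plus ennreal_mult mix_density_nonneg mult_nonneg_nonneg less_imp_le)
      then show "(\<integral>\<^sup>+x. ennreal (path_density p q a t x) * indicator A x \<partial>lborel)
        = (\<integral>\<^sup>+x. ennreal (1 - a * t) * (ennreal (mix_density p x) * indicator A x)
                + ennreal (a * t) * (ennreal (mix_density q x) * indicator A x) \<partial>lborel)"
        by (simp only: distrib_right mult.assoc)
    qed auto
    also have "\<dots> = ennreal (1 - a * t) * emeasure (chisq_mix p) A + ennreal (a * t) * emeasure (chisq_mix q) A"
      using nn B by (simp add: nn_integral_add nn_integral_cmult chisq_mix_eq_density emeasure_density)
    also have "\<dots> = ennreal ((1 - a * t) * measure (chisq_mix p) A + a * t * measure (chisq_mix q) A)"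
      using r by (simp add: P.emeasure_eq_measure Q.emeasure_eq_measure ennreal_mult ennreal_plus)
    finally show ?thesis by (simp add: algebra_simps)
  qed
  then have "mix_path p q a t = measure_of UNIV (sets borel) (emeasure ?D)"
    unfolding mix_path_def
    by (intro measure_of_eq) (auto simp: sets.sigma_sets_eq[of borel, simplified])
  also have "\<dots> = ?D" using measure_of_of_measure[of ?D] by simp
  finally show D: "mix_path p q a t = ?D" .
  have "path_density p q a t = mix_density (\<lambda>k. p k + a * t * (q k - p k))"
    using path_density_eq[OF assms(1,2)] mix_density_path[OF B] by auto
  moreover note mixing_seq_path[OF assms]
  ultimately show "mix_path p q a t = chisq_mix (\<lambda>k. p k + a * t * (q k - p k))"
    unfolding D using mixing_seq_Bseq
    by (subst chisq_mix_eq_density) (auto simp: mixing_seq_def less_imp_le)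
qed

lemma mix_density_pos:
  assumes "mixing_seq p" "0 < x"
  shows "0 < mix_density p x"
proof -
  have "0 < p 0 * chisq_density (2 * 0 + 1) x"
    using assms chisq_coeff_pos[of 0] chisq_density_odd[OF assms(2), of 0]
    by (auto simp: mixing_seq_def)
  then show ?thesis
    unfolding mix_density_def using assms mixing_seq_Bseq
    by (intro suminf_pos2[where i = 0] summable_chisq_density)
       (auto simp: mixing_seq_def less_imp_le chisq_density_nonneg)
qed

lemma score_eq:
  assumes "mixing_seq p" "finite_pmf q" "0 < x"
  shows "score p q a x = a * (mix_density q x / mix_density p x - 1)"
proof -
  note pos = mix_density_pos[OF assms(1,3)]
  have "((\<lambda>t. ln (mix_density p x + a * t * (mix_density q x - mix_density p x)))
      has_real_derivative a * (mix_density q x / mix_density p x - 1)) (at 0)"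
    using pos by (auto intro!: derivative_eq_intros simp: field_simps)
  then show ?thesis
    unfolding score_def path_density_eq[OF assms(1,2)] by (rule DERIV_imp_deriv)
qed

lemma mix_density_ratio_bounded:
  assumes "mixing_seq p" "finite_pmf q"
  obtains C where "1 \<le> C" "\<And>x. mix_density q x \<le> C * mix_density p x"
proof
  define C where "C = 1 + (\<Sum>k\<in>{k. q k \<noteq> 0}. q k / p k)"
  have fin: "finite {k. q k \<noteq> 0}" and q: "\<And>k. 0 \<le> q k" and p: "\<And>k. 0 < p k"
    using assms by (auto simp: finite_pmf_def mixing_seq_def)
  have nn: "0 \<le> (\<Sum>k\<in>{k. q k \<noteq> 0}. q k / p k)"
    using p q by (intro sum_nonneg divide_nonneg_pos) auto
  then show "1 \<le> C" by (simp add: C_def)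
  have qk: "q k \<le> C * p k" for k
  proof (cases "q k = 0")
    case False
    then have "q k / p k \<le> (\<Sum>k\<in>{k. q k \<noteq> 0}. q k / p k)"
      using p q fin by (intro member_le_sum) (auto intro: divide_nonneg_pos)
    then have "q k / p k \<le> C" by (simp add: C_def)
    then show ?thesis using p[of k] by (simp add: field_simps)
  qed (use p[of k] nn in \<open>auto simp: C_def less_imp_le\<close>)
  fix x
  note B = mixing_seq_Bseq[OF assms(1)] finite_pmf_Bseq[OF assms(2)]
  have "mix_density q x \<le> (\<Sum>k. C * (p k * chisq_density (2 * k + 1) x))"
    unfolding mix_density_def
    by (intro suminf_le summable_mult summable_chisq_density B)
       (use qk chisq_density_nonneg in \<open>auto simp: mult.assoc[symmetric] simp del: of_nat_Suc intro!: mult_right_mono\<close>)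
  also have "\<dots> = C * mix_density p x"
    unfolding mix_density_def by (intro suminf_mult summable_chisq_density B)
  finally show "mix_density q x \<le> C * mix_density p x" .
qed

lemma square_integrable_score:
  assumes "mixing_seq p" "finite_pmf q" "0 \<le> a"
  shows "square_integrable (chisq_mix p) (score p q a)"
proof -
  obtain C where C: "1 \<le> C" "\<And>x. mix_density q x \<le> C * mix_density p x"
    using mix_density_ratio_bounded[OF assms(1,2)] by blast
  have eq: "score p q a
      = (\<lambda>x. if 0 < x then a * (mix_density q x / mix_density p x - 1) else 0)"
  proof
    fix x
    show "score p q a x = (if 0 < x then a * (mix_density q x / mix_density p x - 1) else 0)"
    proof (cases "0 < x")
      case False
      then have "(\<lambda>t. ln (path_density p q a t x)) = (\<lambda>t. 0)"
        by (auto simp: path_density_eq[OF assms(1,2)] mix_density_def)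
      then show ?thesis using False by (simp add: score_def)
    qed (simp add: score_eq[OF assms(1,2)])
  qed
  have m [measurable]: "score p q a \<in> borel_measurable borel"
    unfolding eq by measurable
  have bound: "(score p q a x)\<^sup>2 \<le> (a * C)\<^sup>2" for x
  proof (cases "0 < x")
    case True
    have v: "0 < mix_density p x" using mix_density_pos[OF assms(1) True] .
    have "0 \<le> mix_density q x"
      using assms(2) finite_pmf_Bseq by (intro mix_density_nonneg) (auto simp: finite_pmf_def)
    then have "0 \<le> mix_density q x / mix_density p x" using v by simp
    moreover have "mix_density q x / mix_density p x \<le> C" using C(2)[of x] v by (simp add: field_simps)
    ultimately have "\<bar>mix_density q x / mix_density p x - 1\<bar> \<le> C" using C(1) by (auto simp: abs_le_iff)
    then have "\<bar>score p q a x\<bar> \<le> a * C"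
      unfolding score_eq[OF assms(1,2) True] using assms(3) by (simp add: abs_mult mult_left_mono)
    then show ?thesis by (metis abs_ge_zero power2_abs power_mono)
  qed (simp add: eq)
  interpret P: prob_space "chisq_mix p"
    using assms by (intro prob_space_chisq_mix) (auto simp: mixing_seq_def less_imp_le)
  show ?thesis
    unfolding square_integrable_def
    using bound by (auto intro!: P.integrable_const_bound[where B = "(a * C)\<^sup>2"])
qed

lemma sqrt_linearization:
  assumes "- 1 \<le> (u::real)"
  shows "\<bar>sqrt (1 + u) - 1 - u / 2\<bar> \<le> u\<^sup>2 / 2"
proof -
  define s where "s = sqrt (1 + u)"
  have s: "0 \<le> s" "u = s\<^sup>2 - 1" using assms by (auto simp: s_def)
  have "sqrt (1 + u) - 1 - u / 2 = s - 1 - u / 2" by (simp add: s_def)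
  also have "\<dots> = - ((s - 1)\<^sup>2 / 2)"
    unfolding s(2) by (simp add: power2_eq_square field_simps)
  finally have "sqrt (1 + u) - 1 - u / 2 = - ((s - 1)\<^sup>2 / 2)" .
  moreover have "u\<^sup>2 = (s - 1)\<^sup>2 * (s + 1)\<^sup>2"
    unfolding s(2) by (simp add: power2_eq_square algebra_simps)
  moreover have "(s - 1)\<^sup>2 * 1 \<le> (s - 1)\<^sup>2 * (s + 1)\<^sup>2"
    using s by (intro mult_left_mono) auto
  ultimately show ?thesis by simp
qed

lemma all_paths_differentiable:
  assumes "mixing_seq p" "finite_pmf q" "0 \<le> a"
  shows "differentiable_path p q a"
proof -
  obtain C where C: "1 \<le> C" "\<And>x. mix_density q x \<le> C * mix_density p x"
    using mix_density_ratio_bounded[OF assms(1,2)] by blast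
  define K where "K = (a * C)\<^sup>2 / 2"
  let ?I = "\<lambda>t x. ((sqrt (path_density p q a t x) - sqrt (path_density p q a 0 x)) / t
                - 1 / 2 * score p q a x * sqrt (path_density p q a 0 x))\<^sup>2"
  have nn: "0 \<le> mix_density p x" "0 \<le> mix_density q x" for x
    using assms mixing_seq_Bseq finite_pmf_Bseq
    by (auto intro!: mix_density_nonneg simp: mixing_seq_def finite_pmf_def less_imp_le)
  have bound: "?I t x \<le> t\<^sup>2 * K\<^sup>2 * mix_density p x" if t: "0 < t" "a * t < 1" for t x
  proof (cases "0 < x")
    case True
    define v where "v = mix_density p x"
    define r where "r = mix_density q x / v - 1"
    have v: "0 < v" unfolding v_def using mix_density_pos[OF assms(1) True] .
    have r1: "- 1 \<le> r" unfolding r_def using nn[of x] v by simp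
    have "mix_density q x / v \<le> C"
      using C(2)[of x] v by (simp add: v_def[symmetric] field_simps)
    then have r2: "\<bar>r\<bar> \<le> C"
      using C(1) r1 by (auto simp: r_def abs_le_iff)
    have pd: "path_density p q a t x = v * (1 + a * t * r)" for t
      unfolding path_density_eq[OF assms(1,2)] r_def v_def[symmetric] using v by (simp add: field_simps)
    define u where "u = a * t * r"
    have u1: "- 1 \<le> u"
      unfolding u_def using r1 t assms(3) mult_left_mono[of "-1" r "a * t"] by auto
    have "?I t x = (sqrt v * ((sqrt (1 + u) - 1 - u / 2) / t))\<^sup>2"
    proof -
      have A: "sqrt (path_density p q a t x) = sqrt v * sqrt (1 + u)"
        "sqrt (path_density p q a 0 x) = sqrt v"
        unfolding pd real_sqrt_mult u_def by simp_all
      have B: "score p q a x = u / t"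
        unfolding score_eq[OF assms(1,2) True] v_def[symmetric] r_def[symmetric]
        using t by (simp add: u_def)
      have "(sqrt v * sqrt (1 + u) - sqrt v) / t - 1 / 2 * (u / t) * sqrt v
          = sqrt v * ((sqrt (1 + u) - 1 - u / 2) / t)"
        using t by (simp add: diff_divide_distrib right_diff_distrib mult_ac)
      then show ?thesis unfolding A B by simp
    qed
    also have "\<dots> = v * (\<bar>sqrt (1 + u) - 1 - u / 2\<bar> / t)\<^sup>2"
      using v by (simp add: power_mult_distrib power_divide)
    also have "\<dots> \<le> v * (t * K)\<^sup>2"
    proof (intro mult_left_mono power_mono)
      have "\<bar>sqrt (1 + u) - 1 - u / 2\<bar> / t \<le> (u\<^sup>2 / 2) / t"
        using t sqrt_linearization[OF u1] by (intro divide_right_mono) auto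
      also have "\<dots> = t * ((a * \<bar>r\<bar>)\<^sup>2 / 2)"
        using t by (simp add: u_def power2_eq_square field_simps)
      also have "\<dots> \<le> t * ((a * C)\<^sup>2 / 2)"
        using t r2 assms(3) by (intro mult_left_mono divide_right_mono power_mono) auto
      finally show "\<bar>sqrt (1 + u) - 1 - u / 2\<bar> / t \<le> t * K" by (simp add: K_def)
    qed (use t v in auto)
    finally show ?thesis by (simp add: v_def power_mult_distrib mult_ac)
  next
    case False
    then show ?thesis
      by (simp add: path_density_eq[OF assms(1,2)] mix_density_def)
  qed
  have int1: "(\<integral>\<^sup>+x. ennreal (mix_density p x) \<partial>lborel) = 1"
  proof -
    have pp: "\<And>k. 0 \<le> p k" "p sums 1" using assms by (auto simp: mixing_seq_def less_imp_le)
    from prob_space.emeasure_space_1[OF prob_space_chisq_mix[OF pp]] show ?thesis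
      by (simp add: chisq_mix_eq_density[OF pp(1) Bseq_sums[OF pp(2)]] emeasure_density)
  qed
  have ev: "\<forall>\<^sub>F t in at_right 0. (\<integral>\<^sup>+x. ennreal (?I t x) \<partial>lborel) \<le> ennreal (t\<^sup>2 * K\<^sup>2)"
  proof -
    have "((\<lambda>t. a * t) \<longlongrightarrow> a * 0) (at_right 0)" by (intro tendsto_intros)
    then have "\<forall>\<^sub>F t in at_right 0. a * t < 1" by (rule order_tendstoD) simp
    moreover have "\<forall>\<^sub>F t in at_right (0::real). 0 < t" by (rule eventually_at_right_less)
    ultimately show ?thesis
    proof eventually_elim
      case (elim t)
      have "(\<integral>\<^sup>+x. ennreal (?I t x) \<partial>lborel)
          \<le> (\<integral>\<^sup>+x. ennreal (t\<^sup>2 * K\<^sup>2) * ennreal (mix_density p x) \<partial>lborel)"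
        using bound[of t] elim nn
        by (intro nn_integral_mono) (auto simp flip: ennreal_mult intro!: ennreal_leI)
      also have "\<dots> = ennreal (t\<^sup>2 * K\<^sup>2)" by (simp add: nn_integral_cmult int1)
      finally show ?case .
    qed
  qed
  have "((\<lambda>t. t\<^sup>2 * K\<^sup>2) \<longlongrightarrow> 0\<^sup>2 * K\<^sup>2) (at_right 0)" by (intro tendsto_intros)
  then have "((\<lambda>t. ennreal (t\<^sup>2 * K\<^sup>2)) \<longlongrightarrow> 0) (at_right 0)"
    using tendsto_ennrealI by fastforce
  then show ?thesis
    unfolding differentiable_path_def
    by (rule tendsto_sandwich[rotated 3, of _ _ _ "\<lambda>_. 0"]) (use ev in auto)
qed

end

theory Submission
  imports Defs
begin

text \<open>
  The component \<open>\<chi>\<^sup>2_m\<close> has mean \<open>m\<close>, so \<open>(X - 1)/2\<close> has mean \<open>k\<close> under \<open>\<chi>\<^sup>2_{2k+1}\<close> and mean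
  \<open>\<kappa>(P_r)\<close> under every mixture \<open>P_r\<close>. The estimator \<open>T_n\<close> is therefore an exactly unbiased
  average, and its natural influence function is \<open>h(x) = (x - 1)/2 - \<kappa>(P_p)\<close>. Efficiency says that
  this \<open>h\<close> is the efficient influence function and that \<open>T_n\<close> stays asymptotically normal along the
  paths.

  The derivative of \<open>\<kappa>\<close> along the path with parameters \<open>q\<close>, \<open>a\<close> is \<open>a (\<kappa>(P_q) - \<kappa>(P_p))\<close>. The inner
  product of \<open>h\<close> with the score \<open>a (v_q/v_p - 1)\<close> has the same value, because the density \<open>v_p\<close>
  cancels (\<open>integral_mult_score\<close>). What remains is that \<open>h\<close> itself, and not just its projection,
  lies in the closed span of the scores. The scores span all functions \<open>\<Sum>k. c_k (f_{2k+1}/v_p - 1)\<close> with finitely many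
  terms. Since \<open>x f_m(x) = m f_{m+2}(x)\<close>, multiplying a finite combination of the densities
  \<open>f_{2k+1}\<close> by \<open>h\<close> gives another such combination. Apply this to the partial sums \<open>v_n\<close> of
  \<open>v_p = \<Sum>k. p_k f_{2k+1}\<close>: up to a constant that tends to \<open>0\<close>, \<open>h v_n / v_p\<close> lies in the span, and
  it tends to \<open>h\<close> in \<open>L\<^sub>2(P_p)\<close> by dominated convergence, as \<open>0 \<le> v_n \<le> v_p\<close>
  (\<open>influence_in_closed_span\<close>). The finite second moment of \<open>p\<close> makes \<open>h\<close> square-integrable.

  Regularity is a central limit theorem for a triangular array with independent, identically
  distributed rows (\<open>weak_conv_iid_rows\<close>), proved with characteristic functions. Its Lindeberg
  condition holds because \<open>q\<close> has finite support and all \<open>p_k\<close> are positive: then \<open>v_q \<le> C v_p\<close> for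
  some constant \<open>C \<ge> 1\<close>, so all laws on the path are dominated by \<open>C P_p\<close>, and a single integrable bound under \<open>P_p\<close> serves for all
  rows (\<open>truncated_moment_tendsto_0\<close>).
\<close>

section \<open>Moments of chi-squared mixtures\<close>

text \<open>The common part of \<^const>\<open>mixing_seq\<close> and \<^const>\<open>finite_pmf\<close>: the moment
  formulas are needed for the base point \<open>p\<close>, for the direction \<open>q\<close>, and for the points of the
  path between them.\<close>

definition second_moment_weights :: "(nat \<Rightarrow> real) \<Rightarrow> bool" where
  "second_moment_weights r \<longleftrightarrow>
     (\<forall>k. 0 \<le> r k) \<and> r sums 1 \<and> summable (\<lambda>k. (real k)\<^sup>2 * r k)"

lemma second_moment_weightsD:
  assumes "second_moment_weights r"
  shows "0 \<le> r k" "r sums 1" "summable (\<lambda>k. (real k)\<^sup>2 * r k)" "Bseq r"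
  using assms Bseq_sums by (auto simp: second_moment_weights_def)

lemma second_moment_weights_mixing_seq: "mixing_seq p \<Longrightarrow> second_moment_weights p"
  by (auto simp: second_moment_weights_def mixing_seq_def less_imp_le)

lemma second_moment_weights_finite_pmf: "finite_pmf q \<Longrightarrow> second_moment_weights q"
  using finite_pmf_summable by (auto simp: second_moment_weights_def finite_pmf_def)

lemma summable_mean:
  assumes "second_moment_weights r"
  shows "summable (\<lambda>k. real k * r k)"
proof (rule summable_comparison_test'[where N = 0, OF second_moment_weightsD(3)[OF assms]])
  fix k :: nat
  have "real k \<le> (real k)\<^sup>2"
    by (cases k) (auto simp: power2_eq_square)
  then show "norm (real k * r k) \<le> (real k)\<^sup>2 * r k"
    using second_moment_weightsD(1)[OF assms, of k] by (auto intro: mult_right_mono)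
qed

text \<open>Size-biasing raises the degrees of freedom by two, because
  \<open>\<Gamma>(m/2 + 1) = (m/2) \<Gamma>(m/2)\<close>. Both moments of the chi-squared law come from this identity and
  the total mass of \<open>f_m\<close>, and it is also the reason why the influence function can be
  expanded in scores.\<close>

lemma mult_chisq_density:
  assumes "0 < m"
  shows "x * chisq_density m x = real m * chisq_density (m + 2) x"
proof (cases "0 < x")
  case True
  have "Gamma (real m / 2 + 1) = real m / 2 * Gamma (real m / 2)"
    using assms by (intro Gamma_plus1) (auto elim!: nonpos_Ints_cases)
  moreover have "real (m + 2) / 2 = real m / 2 + 1" "real m / 2 + 1 - 1 = (real m / 2 - 1) + 1"
    by (simp_all add: field_simps)
  moreover have "Gamma (real m / 2) \<noteq> 0"
    using assms by (intro less_imp_neq[symmetric] Gamma_real_pos) simp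
  ultimately show ?thesis
    using True assms unfolding chisq_density_def
    by (simp only: powr_add powr_one_gt_zero_iff if_True) (simp add: field_simps)
qed simp

lemma nn_integral_chisq_density:
  "0 < m \<Longrightarrow> (\<integral>\<^sup>+x. ennreal (chisq_density m x) \<partial>lborel) = 1"
  using prob_space.emeasure_space_1[OF prob_space_chisq, of m]
  by (simp add: chisq_def emeasure_density)

lemma nn_integral_chisq_first_moment:
  assumes "0 < m"
  shows "(\<integral>\<^sup>+x. ennreal (x * chisq_density m x) \<partial>lborel) = ennreal (real m)"
  using nn_integral_chisq_density[of "m + 2"]
  by (simp add: mult_chisq_density[OF assms] ennreal_mult chisq_density_nonneg nn_integral_cmult)

lemma nn_integral_chisq_second_moment:
  assumes "0 < m"
  shows "(\<integral>\<^sup>+x. ennreal (x\<^sup>2 * chisq_density m x) \<partial>lborel) = ennreal (real m * real (m + 2))"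
proof -
  have "x\<^sup>2 * chisq_density m x = (real m * real (m + 2)) * chisq_density (m + 2 + 2) x" for x
    using mult_chisq_density[OF assms, of x] mult_chisq_density[of "m + 2" x]
    by (simp add: power2_eq_square mult.assoc mult.left_commute)
  then show ?thesis
    using nn_integral_chisq_density[of "m + 2 + 2"]
    by (simp add: ennreal_mult chisq_density_nonneg nn_integral_cmult)
qed

lemma mix_density_nonpos [simp]: "x \<le> 0 \<Longrightarrow> mix_density r x = 0"
  by (simp add: mix_density_def)

lemma AE_chisq_mix_pos:
  assumes "\<And>k. 0 \<le> r k" "Bseq r"
  shows "AE x in chisq_mix r. 0 < x"
  unfolding chisq_mix_eq_density[OF assms]
  by (subst AE_density) (auto intro!: AE_I2 simp flip: not_le)

text \<open>Monotone convergence reduces an integral against the mixture to those against its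
  components. Nonnegativity of \<open>g\<close> is asked for only on the half-line that carries the law, so that
  \<open>g x = x\<close> is covered.\<close>

lemma has_bochner_integral_chisq_mix:
  assumes r: "\<And>k. 0 \<le> r k" "Bseq r"
    and g [measurable]: "g \<in> borel_measurable borel" and pos: "\<And>x. 0 < x \<Longrightarrow> 0 \<le> g x"
    and e: "\<And>k. (\<integral>\<^sup>+x. ennreal (g x * chisq_density (2 * k + 1) x) \<partial>lborel) = ennreal (e k)"
      "\<And>k. 0 \<le> e k"
    and sum: "summable (\<lambda>k. r k * e k)"
  shows "has_bochner_integral (chisq_mix r) g (\<Sum>k. r k * e k)"
proof (rule has_bochner_integral_nn_integral)
  show "g \<in> borel_measurable (chisq_mix r)" by simp
  show "AE x in chisq_mix r. 0 \<le> g x"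
    using AE_chisq_mix_pos[OF r] by eventually_elim (rule pos)
  show "0 \<le> (\<Sum>k. r k * e k)"
    using r e sum by (intro suminf_nonneg) auto
  have "(\<integral>\<^sup>+x. ennreal (g x) \<partial>chisq_mix r)
      = (\<integral>\<^sup>+x. ennreal (mix_density r x) * ennreal (g x) \<partial>lborel)"
    unfolding chisq_mix_eq_density[OF r] by (subst nn_integral_density) auto
  also have "\<dots> = (\<integral>\<^sup>+x. (\<Sum>k. ennreal (r k) * ennreal (g x * chisq_density (2 * k + 1) x)) \<partial>lborel)"
  proof (rule nn_integral_cong)
    fix x :: real
    show "ennreal (mix_density r x) * ennreal (g x)
        = (\<Sum>k. ennreal (r k) * ennreal (g x * chisq_density (2 * k + 1) x))"
    proof (cases "0 < x")
      case True
      note s = summable_chisq_density[OF r(2), of x]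
      have "ennreal (mix_density r x) * ennreal (g x) = ennreal (g x * mix_density r x)"
        using pos[OF True] mix_density_nonneg[OF r, of x] by (simp add: ennreal_mult mult.commute)
      also have "g x * mix_density r x = (\<Sum>k. g x * (r k * chisq_density (2 * k + 1) x))"
        unfolding mix_density_def by (rule suminf_mult[OF s, symmetric])
      also have "ennreal \<dots> = (\<Sum>k. ennreal (g x * (r k * chisq_density (2 * k + 1) x)))"
        using pos[OF True] r chisq_density_nonneg
        by (intro suminf_ennreal2[symmetric] summable_mult s) auto
      also have "\<dots> = (\<Sum>k. ennreal (r k) * ennreal (g x * chisq_density (2 * k + 1) x))"
        using pos[OF True] r chisq_density_nonneg
        by (intro suminf_cong) (simp add: mult.left_commute flip: ennreal_mult)
      finally show ?thesis .
    qed simp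
  qed
  also have "\<dots> = (\<Sum>k. \<integral>\<^sup>+x. ennreal (r k) * ennreal (g x * chisq_density (2 * k + 1) x) \<partial>lborel)"
    by (intro nn_integral_suminf) auto
  also have "\<dots> = (\<Sum>k. ennreal (r k) * ennreal (e k))"
    by (intro suminf_cong, subst nn_integral_cmult) (auto simp: e(1)[simplified])
  also have "\<dots> = (\<Sum>k. ennreal (r k * e k))"
    using r e by (simp add: ennreal_mult)
  also have "\<dots> = ennreal (\<Sum>k. r k * e k)"
    using r e sum by (intro suminf_ennreal2) auto
  finally show "(\<integral>\<^sup>+x. ennreal (g x) \<partial>chisq_mix r) = ennreal (\<Sum>k. r k * e k)" .
qed

definition weights_mean :: "(nat \<Rightarrow> real) \<Rightarrow> real" where
  "weights_mean r = (\<Sum>k. real k * r k)"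

text \<open>The factors \<open>(2k + 1)(2k + 3)\<close> are the second moments of the components.\<close>

definition mix_second_moment :: "(nat \<Rightarrow> real) \<Rightarrow> real" where
  "mix_second_moment r = (\<Sum>k. (2 * real k + 1) * (2 * real k + 3) * r k)"

lemma summable_mix_second_moment:
  assumes "second_moment_weights r"
  shows "summable (\<lambda>k. (2 * real k + 1) * (2 * real k + 3) * r k)"
proof -
  have "summable (\<lambda>k. 4 * ((real k)\<^sup>2 * r k) + 8 * (real k * r k) + 3 * r k)"
    using second_moment_weightsD[OF assms] summable_mean[OF assms]
    by (intro summable_add summable_mult) (auto simp: sums_iff)
  then show ?thesis by (simp add: algebra_simps power2_eq_square)
qed

lemma weights_mean_path:
  assumes "second_moment_weights p" "second_moment_weights q"
  shows "weights_mean (\<lambda>k. p k + c * (q k - p k))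
       = weights_mean p + c * (weights_mean q - weights_mean p)"
proof -
  have "(\<lambda>k. real k * p k + c * (real k * q k - real k * p k)) sums
      (weights_mean p + c * (weights_mean q - weights_mean p))"
    unfolding weights_mean_def
    by (intro sums_add sums_mult sums_diff summable_sums summable_mean assms)
  then show ?thesis by (simp add: weights_mean_def sums_iff algebra_simps)
qed

lemma mix_second_moment_path:
  assumes "second_moment_weights p" "second_moment_weights q"
  shows "mix_second_moment (\<lambda>k. p k + c * (q k - p k))
       = mix_second_moment p + c * (mix_second_moment q - mix_second_moment p)"
proof -
  let ?w = "\<lambda>k. (2 * real k + 1) * (2 * real k + 3)"
  have "(\<lambda>k. ?w k * p k + c * (?w k * q k - ?w k * p k)) sums
      (mix_second_moment p + c * (mix_second_moment q - mix_second_moment p))"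
    unfolding mix_second_moment_def
    by (intro sums_add sums_mult sums_diff summable_sums summable_mix_second_moment assms)
  moreover have "?w k * p k + c * (?w k * q k - ?w k * p k) = ?w k * (p k + c * (q k - p k))" for k
    by (simp only: distrib_left right_diff_distrib mult_ac)
  ultimately show ?thesis by (simp add: mix_second_moment_def sums_iff)
qed

lemma chisq_mix_first_moment:
  assumes "second_moment_weights r"
  shows "has_bochner_integral (chisq_mix r) (\<lambda>x. x) (2 * weights_mean r + 1)"
proof -
  note r = second_moment_weightsD[OF assms]
  have "(\<lambda>k. 2 * (real k * r k) + r k) sums (2 * weights_mean r + 1)"
    unfolding weights_mean_def
    by (intro sums_add sums_mult summable_sums summable_mean assms r)
  then have s: "(\<lambda>k. r k * (2 * real k + 1)) sums (2 * weights_mean r + 1)"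
    by (simp add: algebra_simps)
  have "has_bochner_integral (chisq_mix r) (\<lambda>x. x) (\<Sum>k. r k * (2 * real k + 1))"
    using s nn_integral_chisq_first_moment[of "2 * k + 1" for k]
    by (intro has_bochner_integral_chisq_mix r) (auto simp: sums_iff add.commute)
  then show ?thesis using s by (simp add: sums_iff)
qed

lemma chisq_mix_second_moment:
  assumes "second_moment_weights r"
  shows "has_bochner_integral (chisq_mix r) (\<lambda>x. x\<^sup>2) (mix_second_moment r)"
proof -
  note r = second_moment_weightsD[OF assms]
  have "(\<integral>\<^sup>+x. ennreal (x\<^sup>2 * chisq_density (2 * k + 1) x) \<partial>lborel)
      = ennreal ((2 * real k + 1) * (2 * real k + 3))" for k
    using nn_integral_chisq_second_moment[of "2 * k + 1"] by (simp add: add_ac)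
  then have "has_bochner_integral (chisq_mix r) (\<lambda>x. x\<^sup>2)
      (\<Sum>k. r k * ((2 * real k + 1) * (2 * real k + 3)))"
    using summable_mix_second_moment[OF assms]
    by (intro has_bochner_integral_chisq_mix r) (auto simp: mult_ac)
  then show ?thesis by (simp add: mix_second_moment_def mult_ac)
qed

lemma prob_space_weights: "second_moment_weights r \<Longrightarrow> prob_space (chisq_mix r)"
  using prob_space_chisq_mix second_moment_weightsD by blast

text \<open>The estimator is the average of \<open>X/2 - 1/2\<close>, so both the influence function and the centred
  summands of the estimator have the form \<open>x/2 - b\<close>.\<close>

lemma centred_half_moments:
  assumes "second_moment_weights r"
  shows "has_bochner_integral (chisq_mix r) (\<lambda>x. x / 2 - b) (weights_mean r + 1 / 2 - b)"
    and "has_bochner_integral (chisq_mix r) (\<lambda>x. (x / 2 - b)\<^sup>2)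
           (mix_second_moment r / 4 - b * (2 * weights_mean r + 1) + b\<^sup>2)"
proof -
  interpret prob_space "chisq_mix r" by (rule prob_space_weights[OF assms])
  have c: "has_bochner_integral (chisq_mix r) (\<lambda>x. c) c" for c :: real
    by (simp add: has_bochner_integral_iff prob_space[simplified])
  note m = chisq_mix_first_moment[OF assms] chisq_mix_second_moment[OF assms]
  have "has_bochner_integral (chisq_mix r) (\<lambda>x. x / 2 - b) ((2 * weights_mean r + 1) / 2 - b)"
    by (intro has_bochner_integral_diff has_bochner_integral_divide_zero m c)
  then show "has_bochner_integral (chisq_mix r) (\<lambda>x. x / 2 - b) (weights_mean r + 1 / 2 - b)"
    by (simp add: add_divide_distrib)
  have "has_bochner_integral (chisq_mix r) (\<lambda>x. x\<^sup>2 / 4 - b * x + b\<^sup>2)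
           (mix_second_moment r / 4 - b * (2 * weights_mean r + 1) + b\<^sup>2)"
    by (intro has_bochner_integral_add has_bochner_integral_diff
        has_bochner_integral_divide_zero has_bochner_integral_mult_right m c)
  then show "has_bochner_integral (chisq_mix r) (\<lambda>x. (x / 2 - b)\<^sup>2)
           (mix_second_moment r / 4 - b * (2 * weights_mean r + 1) + b\<^sup>2)"
    by (simp add: power2_diff power_divide mult.commute[of _ b] add_diff_eq diff_add_eq)
qed

section \<open>The influence function\<close>

text \<open>This is \<open>(x - 1)/2 - \<kappa>(P_p)\<close>, and \<open>(x - 1)/2\<close> has mean \<open>k\<close> under the component
  \<open>\<chi>\<^sup>2_{2k+1}\<close>.\<close>

definition influence :: "(nat \<Rightarrow> real) \<Rightarrow> real \<Rightarrow> real" where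
  "influence p x = x / 2 - (weights_mean p + 1 / 2)"

lemma influence_measurable [measurable]: "influence p \<in> borel_measurable borel"
  unfolding influence_def[abs_def] by measurable

lemma has_bochner_integral_influence:
  assumes "second_moment_weights r"
  shows "has_bochner_integral (chisq_mix r) (influence p) (weights_mean r - weights_mean p)"
  using centred_half_moments(1)[OF assms, of "weights_mean p + 1 / 2"]
  unfolding influence_def[abs_def] by simp

lemma has_bochner_integral_influence_square:
  assumes "second_moment_weights p"
  shows "has_bochner_integral (chisq_mix p) (\<lambda>x. (influence p x)\<^sup>2)
           (mix_second_moment p / 4 - (weights_mean p + 1 / 2)\<^sup>2)"
  using centred_half_moments(2)[OF assms, of "weights_mean p + 1 / 2"]
  unfolding influence_def by (simp add: power2_eq_square algebra_simps)

lemma kappa_mix_path: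
  assumes "mixing_seq p" "finite_pmf q" "0 \<le> a" "0 \<le> t" "a * t < 1"
  shows "kappa (mix_path p q a t) = weights_mean p + a * t * (weights_mean q - weights_mean p)"
  unfolding mix_path_eq(1)[OF assms] kappa_chisq_mix[OF mixing_seq_path[OF assms]]
    weights_mean_def[symmetric]
  by (intro weights_mean_path second_moment_weights_mixing_seq second_moment_weights_finite_pmf assms)

text \<open>Along a path \<open>\<kappa>\<close> is affine, so the difference quotient is constant near \<open>0\<close>.\<close>

lemma kappa_derivative:
  assumes "mixing_seq p" "finite_pmf q" "0 \<le> a"
  shows "((\<lambda>t. (kappa (mix_path p q a t) - kappa (chisq_mix p)) / t)
          \<longlongrightarrow> a * (weights_mean q - weights_mean p)) (at_right 0)"
proof (rule tendsto_eventually)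
  have "((\<lambda>t. a * t) \<longlongrightarrow> a * 0) (at_right 0)" by (intro tendsto_intros)
  then have "\<forall>\<^sub>F t in at_right 0. a * t < 1" by (rule order_tendstoD) simp
  moreover have "\<forall>\<^sub>F t in at_right (0::real). 0 < t" by (rule eventually_at_right_less)
  ultimately show "\<forall>\<^sub>F t in at_right 0. (kappa (mix_path p q a t) - kappa (chisq_mix p)) / t
      = a * (weights_mean q - weights_mean p)"
  proof eventually_elim
    case (elim t)
    then show ?case
      using kappa_mix_path[of p q a t] kappa_chisq_mix[of p] assms
      by (simp add: weights_mean_def)
  qed
qed

lemma integral_chisq_mix:
  assumes "second_moment_weights r" "g \<in> borel_measurable borel"
  shows "(\<integral>x. g x \<partial>chisq_mix r) = (\<integral>x. mix_density r x * g x \<partial>lborel)"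
    and "integrable (chisq_mix r) g \<longleftrightarrow> integrable lborel (\<lambda>x. mix_density r x * g x)"
  using assms second_moment_weightsD[OF assms(1)] mix_density_nonneg
  by (simp_all add: chisq_mix_eq_density integral_density integrable_density)

text \<open>The density cancels: \<open>v_p \<cdot> score = a (v_q - v_p)\<close>. Hence pairing with the score is the
  derivative of the mean of \<open>g\<close> along the path.\<close>

lemma integral_mult_score:
  assumes p: "mixing_seq p" and q: "finite_pmf q" and a: "0 \<le> a"
    and g [measurable]: "g \<in> borel_measurable borel"
    and int: "integrable (chisq_mix p) g" "integrable (chisq_mix q) g"
  shows "(\<integral>x. g x * score p q a x \<partial>chisq_mix p)
       = a * ((\<integral>x. g x \<partial>chisq_mix q) - (\<integral>x. g x \<partial>chisq_mix p))"
proof -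
  note w = second_moment_weights_mixing_seq[OF p] second_moment_weights_finite_pmf[OF q]
  have [measurable]: "score p q a \<in> borel_measurable borel"
    using square_integrable_score[OF p q a]
    by (simp add: square_integrable_def measurable_cong_sets[OF sets_chisq_mix refl])
  have "(\<integral>x. g x * score p q a x \<partial>chisq_mix p)
      = (\<integral>x. mix_density p x * (g x * score p q a x) \<partial>lborel)"
    by (rule integral_chisq_mix[OF w(1)]) measurable
  also have "\<dots> = (\<integral>x. a * (mix_density q x * g x - mix_density p x * g x) \<partial>lborel)"
  proof (rule Bochner_Integration.integral_cong)
    fix x :: real
    show "mix_density p x * (g x * score p q a x)
        = a * (mix_density q x * g x - mix_density p x * g x)"
    proof (cases "0 < x")
      case True
      then show ?thesis
        using mix_density_pos[OF p True] by (simp add: score_eq[OF p q True] field_simps)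
    qed simp
  qed simp
  also have "\<dots> = a * ((\<integral>x. g x \<partial>chisq_mix q) - (\<integral>x. g x \<partial>chisq_mix p))"
    using int by (simp add: integral_chisq_mix[OF w(1)] integral_chisq_mix[OF w(2)])
  finally show ?thesis .
qed

section \<open>Membership in the closed span of the scores\<close>

definition point_weights :: "nat \<Rightarrow> nat \<Rightarrow> real" where
  "point_weights k j = (if j = k then 1 else 0)"

lemma finite_pmf_point_weights: "finite_pmf (point_weights k)"
  using sums_single[of k "\<lambda>_. 1 :: real"]
  by (simp add: finite_pmf_def point_weights_def[abs_def])

text \<open>Thus the score in the direction of the \<open>k\<close>-th component is \<open>f_{2k+1}/v_p - 1\<close>.\<close>

lemma mix_density_point_weights: "mix_density (point_weights k) x = chisq_density (2 * k + 1) x"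
proof -
  have "(\<lambda>j. point_weights k j * chisq_density (2 * j + 1) x)
      = (\<lambda>j. if j = k then chisq_density (2 * j + 1) x else 0)"
    by (auto simp: point_weights_def)
  then show ?thesis
    unfolding mix_density_def using sums_single[of k "\<lambda>j. chisq_density (2 * j + 1) x"]
    by (simp add: sums_iff)
qed

text \<open>Write \<open>v_n\<close> for the part of \<open>v_p\<close> with index below \<open>n\<close>. By size-biasing,
  \<open>x f_{2k+1}/2 = (k + 1/2) f_{2k+3}\<close>, so \<open>influence \<cdot> v_n\<close> is a linear combination of the first
  \<open>n + 1\<close> component densities. After division by \<open>v_p\<close>, it is a linear combination of scores up to
  the sum of the coefficients, which is the constant subtracted below.\<close>

lemma truncated_influence_in_span:
  assumes p: "mixing_seq p"
  obtains c where "\<And>x. 0 < x \<Longrightarrow> (\<Sum>i<Suc n. c i * score p (point_weights i) 1 x)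
      = influence p x * ((\<Sum>k<n. p k * chisq_density (2 * k + 1) x) / mix_density p x)
        - (\<Sum>k<n. p k * (real k - weights_mean p))"
proof
  let ?m = "weights_mean p"
  \<comment> \<open>\<open>\<beta>\<close> expands \<open>x/2 \<cdot> v_n\<close>, with indices shifted by one, and \<open>\<alpha>\<close> expands \<open>(\<kappa>(P_p) + 1/2) \<cdot> v_n\<close>.\<close>
  define \<alpha> where "\<alpha> i = (if i < n then p i * (?m + 1 / 2) else 0)" for i
  define \<beta> where "\<beta> i = (case i of 0 \<Rightarrow> 0 | Suc k \<Rightarrow> p k * (real k + 1 / 2))" for i
  fix x :: real assume x: "0 < x"
  define u where "u i = chisq_density (2 * i + 1) x / mix_density p x - 1" for i
  have v: "0 < mix_density p x" by (rule mix_density_pos[OF p x])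
  have "(\<Sum>i<Suc n. (\<beta> i - \<alpha> i) * score p (point_weights i) 1 x)
      = (\<Sum>i<Suc n. \<beta> i * u i) - (\<Sum>i<Suc n. \<alpha> i * u i)"
    by (simp only: score_eq[OF p finite_pmf_point_weights x] mix_density_point_weights u_def
        left_diff_distrib sum_subtractf mult_1)
  also have "(\<Sum>i<Suc n. \<beta> i * u i) = (\<Sum>k<n. p k * (real k + 1 / 2) * u (Suc k))"
    by (subst sum.lessThan_Suc_shift) (simp add: \<beta>_def)
  also have "(\<Sum>i<Suc n. \<alpha> i * u i) = (\<Sum>k<n. p k * (?m + 1 / 2) * u k)"
    by (simp add: \<alpha>_def)
  also have "(\<Sum>k<n. p k * (real k + 1 / 2) * u (Suc k)) - (\<Sum>k<n. p k * (?m + 1 / 2) * u k)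
      = (\<Sum>k<n. influence p x / mix_density p x * (p k * chisq_density (2 * k + 1) x)
            - p k * (real k - ?m))"
    unfolding sum_subtractf[symmetric]
  proof (rule sum.cong)
    fix k
    have shift: "(real k + 1 / 2) * chisq_density (2 * Suc k + 1) x = x / 2 * chisq_density (2 * k + 1) x"
      using mult_chisq_density[of "2 * k + 1" x] by (simp add: field_simps)
    have "(real k + 1 / 2) * u (Suc k)
        = x / 2 * chisq_density (2 * k + 1) x / mix_density p x - (real k + 1 / 2)"
      by (simp only: u_def right_diff_distrib times_divide_eq_right mult_1_right
          shift[unfolded times_divide_eq_right])
    then have "p k * (real k + 1 / 2) * u (Suc k) - p k * (?m + 1 / 2) * u k
        = p k * (x / 2 * chisq_density (2 * k + 1) x / mix_density p x - (real k + 1 / 2))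
          - p k * (?m + 1 / 2) * u k"
      by (simp only: mult.assoc)
    also have "\<dots> = influence p x / mix_density p x * (p k * chisq_density (2 * k + 1) x)
            - p k * (real k - ?m)"
      unfolding u_def influence_def using v by (simp add: field_simps)
    finally show "p k * (real k + 1 / 2) * u (Suc k) - p k * (?m + 1 / 2) * u k
        = influence p x / mix_density p x * (p k * chisq_density (2 * k + 1) x)
            - p k * (real k - ?m)" .
  qed simp
  also have "\<dots> = influence p x * ((\<Sum>k<n. p k * chisq_density (2 * k + 1) x) / mix_density p x)
        - (\<Sum>k<n. p k * (real k - ?m))"
    by (simp only: sum_subtractf sum_distrib_left[symmetric]) simp
  finally show "(\<Sum>i<Suc n. (\<beta> i - \<alpha> i) * score p (point_weights i) 1 x)
      = influence p x * ((\<Sum>k<n. p k * chisq_density (2 * k + 1) x) / mix_density p x)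
        - (\<Sum>k<n. p k * (real k - ?m))" .
qed

lemma square_diff_le: "(a - b)\<^sup>2 \<le> 2 * a\<^sup>2 + 2 * (b::real)\<^sup>2"
  using zero_le_power2[of "a + b"] by (simp add: power2_eq_square algebra_simps)

text \<open>The combinations from \<open>truncated_influence_in_span\<close> converge to the influence function in
  \<open>L\<^sub>2(P_p)\<close>: since \<open>0 \<le> v_n/v_p \<le> 1\<close> and \<open>v_n/v_p\<close> tends to \<open>1\<close> pointwise, dominated convergence
  applies, and the additive constants tend to \<open>\<Sum>k. p_k (k - \<kappa>) = 0\<close>.\<close>

lemma influence_in_closed_span:
  assumes p: "mixing_seq p"
  shows "in_closed_span (chisq_mix p) (tangent_set p) (influence p)"
proof -
  note w = second_moment_weights_mixing_seq[OF p]
  interpret P: prob_space "chisq_mix p" by (rule prob_space_weights[OF w])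
  note pp = second_moment_weightsD[OF w]
  have sq: "integrable (chisq_mix p) (\<lambda>x. (influence p x)\<^sup>2)"
    using has_bochner_integral_influence_square[OF w] by (simp add: has_bochner_integral_iff)
  define vn where "vn n x = (\<Sum>k<n. p k * chisq_density (2 * k + 1) x)" for n x
  define s where "s n = (\<Sum>k<n. p k * (real k - weights_mean p))" for n
  define e where
    "e n x = influence p x * (1 - vn n x / mix_density p x) - (- s n)" for n x
  have [measurable]: "vn n \<in> borel_measurable borel" for n
    unfolding vn_def[abs_def] by measurable
  have [measurable]: "e n \<in> borel_measurable borel" for n
    unfolding e_def[abs_def] by measurable
  have s0: "s \<longlonglongrightarrow> 0"
  proof -
    have "(\<lambda>k. real k * p k - weights_mean p * p k) sums (weights_mean p - weights_mean p * 1)"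
      unfolding weights_mean_def
      by (intro sums_diff sums_mult summable_sums summable_mean w pp)
    then show ?thesis unfolding s_def[abs_def] sums_def by (simp add: algebra_simps)
  qed
  then obtain K where K: "\<bar>s n\<bar> \<le> K" for n
    using convergent_imp_Bseq[of s] by (auto simp: convergent_def Bseq_def)
  have bound: "AE x in chisq_mix p. norm ((e n x)\<^sup>2) \<le> 2 * (influence p x)\<^sup>2 + 2 * K\<^sup>2" for n
    using AE_chisq_mix_pos[OF pp(1,4)]
  proof eventually_elim
    case (elim x)
    have v: "0 < mix_density p x" by (rule mix_density_pos[OF p elim])
    have "vn n x \<le> mix_density p x" unfolding vn_def mix_density_def
      using pp chisq_density_nonneg
      by (intro sum_le_suminf summable_chisq_density) auto
    moreover have "0 \<le> vn n x" unfolding vn_def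
      using pp chisq_density_nonneg by (intro sum_nonneg) auto
    ultimately have "0 \<le> 1 - vn n x / mix_density p x" "1 - vn n x / mix_density p x \<le> 1"
      using v by auto
    then have "(1 - vn n x / mix_density p x)\<^sup>2 \<le> 1" by (rule power_le_one)
    then have "(influence p x * (1 - vn n x / mix_density p x))\<^sup>2 \<le> (influence p x)\<^sup>2"
      unfolding power_mult_distrib by (intro mult_left_le) auto
    moreover have "(s n)\<^sup>2 \<le> K\<^sup>2"
      using K[of n] by (rule power2_le_iff_abs_le[THEN iffD2, rotated]) (use K[of n] in linarith)
    ultimately show ?case
      unfolding e_def using square_diff_le[of "influence p x * (1 - vn n x / mix_density p x)" "- s n"]
      by simp
  qed
  have lim: "(\<lambda>n. (\<integral>x. (e n x)\<^sup>2 \<partial>chisq_mix p)) \<longlonglongrightarrow> (\<integral>x. 0 \<partial>chisq_mix p)"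
  proof (rule integral_dominated_convergence[where w = "\<lambda>x. 2 * (influence p x)\<^sup>2 + 2 * K\<^sup>2"])
    show "AE x in chisq_mix p. (\<lambda>n. (e n x)\<^sup>2) \<longlonglongrightarrow> 0"
      using AE_chisq_mix_pos[OF pp(1,4)]
    proof eventually_elim
      case (elim x)
      have "(\<lambda>n. vn n x) \<longlonglongrightarrow> mix_density p x"
        using summable_LIMSEQ[OF summable_chisq_density[OF pp(4), of x]]
        by (simp add: vn_def mix_density_def)
      then have "(\<lambda>n. (e n x)\<^sup>2) \<longlonglongrightarrow>
          (influence p x * (1 - mix_density p x / mix_density p x) - (- 0))\<^sup>2"
        unfolding e_def using mix_density_pos[OF p elim] by (intro tendsto_intros s0) auto
      then show ?case using mix_density_pos[OF p elim] by simp
    qed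
  qed (use sq bound in auto)
  have int_e: "integrable (chisq_mix p) (\<lambda>x. (e n x)\<^sup>2)" for n
  proof (rule Bochner_Integration.integrable_bound)
    show "integrable (chisq_mix p) (\<lambda>x. 2 * (influence p x)\<^sup>2 + 2 * K\<^sup>2)"
      using sq by simp
    show "AE x in chisq_mix p. norm ((e n x)\<^sup>2) \<le> norm (2 * (influence p x)\<^sup>2 + 2 * K\<^sup>2)"
      using bound[of n] by eventually_elim simp
  qed simp
  show ?thesis
    unfolding in_closed_span_def square_integrable_def
  proof (intro conjI allI impI)
    show "influence p \<in> borel_measurable (chisq_mix p)" by simp
    fix \<epsilon> :: real assume "0 < \<epsilon>"
    with lim have "\<forall>\<^sub>F n in sequentially. (\<integral>x. (e n x)\<^sup>2 \<partial>chisq_mix p) < \<epsilon>"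
      by (intro order_tendstoD) auto
    then obtain n where n: "(\<integral>x. (e n x)\<^sup>2 \<partial>chisq_mix p) < \<epsilon>"
      by (auto simp: eventually_sequentially)
    obtain c where c: "\<And>x. 0 < x \<Longrightarrow> (\<Sum>i<Suc n. c i * score p (point_weights i) 1 x)
      = influence p x * (vn n x / mix_density p x) - s n"
      using truncated_influence_in_span[OF p, of n] unfolding vn_def s_def by blast
    have "(\<integral>\<^sup>+ x. ennreal ((influence p x
          - (\<Sum>i<Suc n. c i * score p (point_weights i) 1 x))\<^sup>2) \<partial>chisq_mix p)
        = (\<integral>\<^sup>+ x. ennreal ((e n x)\<^sup>2) \<partial>chisq_mix p)"
    proof (rule nn_integral_cong_AE)
      show "AE x in chisq_mix p. ennreal ((influence p x
          - (\<Sum>i<Suc n. c i * score p (point_weights i) 1 x))\<^sup>2) = ennreal ((e n x)\<^sup>2)"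
        using AE_chisq_mix_pos[OF pp(1,4)]
        by eventually_elim (simp only: c e_def, simp add: algebra_simps)
    qed
    also have "\<dots> = ennreal (\<integral>x. (e n x)\<^sup>2 \<partial>chisq_mix p)"
      by (rule nn_integral_eq_integral[OF int_e]) simp
    also have "\<dots> < ennreal \<epsilon>"
      using n \<open>0 < \<epsilon>\<close> by (simp add: ennreal_less_iff)
    finally have *: "(\<integral>\<^sup>+ x. ennreal ((influence p x
          - (\<Sum>i<Suc n. c i * score p (point_weights i) 1 x))\<^sup>2) \<partial>chisq_mix p) < ennreal \<epsilon>" .
    show "\<exists>(N::nat) c g. (\<forall>i<N. g i \<in> tangent_set p) \<and>
        (\<integral>\<^sup>+ x. ennreal ((influence p x - (\<Sum>i<N. c i * g i x))\<^sup>2) \<partial>chisq_mix p) < ennreal \<epsilon>"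
      by (rule exI[of _ "Suc n"], rule exI[of _ c], rule exI[of _ "\<lambda>i. score p (point_weights i) 1"])
         (use * finite_pmf_point_weights in \<open>fastforce simp: tangent_set_def\<close>)
  qed (rule sq)
qed

lemma efficient_influence_kappa:
  assumes p: "mixing_seq p"
  shows "efficient_influence kappa p (influence p)"
  unfolding efficient_influence_def
proof (intro conjI allI impI influence_in_closed_span p)
  fix q :: "nat \<Rightarrow> real" and a :: real
  assume q: "finite_pmf q" and a: "0 \<le> a"
  note i = has_bochner_integral_influence[OF second_moment_weights_mixing_seq[OF p], of p]
    has_bochner_integral_influence[OF second_moment_weights_finite_pmf[OF q], of p]
  have "(\<integral>x. influence p x * score p q a x \<partial>chisq_mix p) = a * (weights_mean q - weights_mean p)"
    using i by (subst integral_mult_score[OF p q a]) (auto simp: has_bochner_integral_iff)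
  then show "((\<lambda>t. (kappa (mix_path p q a t) - kappa (chisq_mix p)) / t)
          \<longlongrightarrow> (\<integral>x. influence p x * score p q a x \<partial>chisq_mix p)) (at_right 0)"
    using kappa_derivative[OF p q a] by simp
qed

section \<open>Triangular arrays with independent, identically distributed rows\<close>

text \<open>The Lindeberg argument for characteristic functions when the law \<open>\<nu> n\<close> of the summands
  changes with the row. The truncated third moment in the last hypothesis, with the factor
  \<open>6 = 3!\<close> from Taylor's formula, bounds the error of the second-order expansion of \<open>char (\<nu> n)\<close> at
  \<open>t / \<surd>n\<close>. Comparing at once with the expansion that has the limiting variance \<open>v\<close> leaves only the
  elementary limit of \<open>(1 - v t\<^sup>2 / (2n))\<^sup>n\<close>.\<close>

lemma char_power_tendsto_gaussian:
  fixes \<nu> :: "nat \<Rightarrow> real measure"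
  assumes real: "\<And>n. real_distribution (\<nu> n)"
    and int: "\<forall>\<^sub>F n in sequentially. integrable (\<nu> n) (\<lambda>x. x\<^sup>2)"
    and mean: "\<forall>\<^sub>F n in sequentially. (\<integral>x. x \<partial>\<nu> n) = 0"
    and var: "(\<lambda>n. \<integral>x. x\<^sup>2 \<partial>\<nu> n) \<longlonglongrightarrow> v"
    and trunc: "\<And>c. 0 \<le> c \<Longrightarrow>
      (\<lambda>n. \<integral>x. min (6 * x\<^sup>2) (c / sqrt (real n) * \<bar>x\<bar> ^ 3) \<partial>\<nu> n) \<longlonglongrightarrow> 0"
  shows "(\<lambda>n. char (\<nu> n) (t / sqrt (real n)) ^ n) \<longlonglongrightarrow> complex_of_real (exp (- (v * t\<^sup>2) / 2))"
proof -
  define s where "s n = (\<integral>x. x\<^sup>2 \<partial>\<nu> n)" for n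
  define L where "L n = (\<integral>x. min (6 * x\<^sup>2) (\<bar>t\<bar> / sqrt (real n) * \<bar>x\<bar> ^ 3) \<partial>\<nu> n)" for n
  define z where "z n = complex_of_real (1 + (- (v * t\<^sup>2) / 2) / real n)" for n
  have v: "0 \<le> v"
    using var by (rule LIMSEQ_le_const) auto
  \<comment> \<open>This makes \<open>z n\<close> a number in \<open>[-1, 1]\<close>, as required for comparing \<open>n\<close>-th powers.\<close>
  have large: "\<forall>\<^sub>F n in sequentially. v * t\<^sup>2 / 4 \<le> real n \<and> 0 < n"
    using eventually_conj[OF filterlim_real_sequentially[unfolded filterlim_at_top, rule_format,
        of "v * t\<^sup>2 / 4"] eventually_gt_at_top[of 0]] .
  have main: "\<forall>\<^sub>F n in sequentially. cmod (char (\<nu> n) (t / sqrt (real n)) ^ n - z n ^ n)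
      \<le> t\<^sup>2 / 6 * L n + t\<^sup>2 / 2 * \<bar>s n - v\<bar>"
    using int mean large
  proof eventually_elim
    case (elim n)
    interpret N: real_distribution "\<nu> n" by (rule real)
    let ?t = "t / sqrt (real n)"
    have n: "0 < real n" using elim by simp
    have t2: "?t\<^sup>2 = t\<^sup>2 / real n" by (simp add: power_divide)
    have id: "integrable (\<nu> n) (\<lambda>x. x)"
      by (rule N.square_integrable_imp_integrable[OF _ elim(1)]) simp
    have "N.variance (\<lambda>x. x) = s n"
      by (simp add: s_def elim(2))
    note N.char_approx3[OF id elim(2,1) this, of ?t]
    then have "cmod (char (\<nu> n) ?t - (1 - ?t\<^sup>2 * s n / 2))
        \<le> ?t\<^sup>2 / 6 * (\<integral>x. min (6 * x\<^sup>2) (\<bar>?t\<bar> * \<bar>x\<bar> ^ 3) \<partial>\<nu> n)"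
      by simp
    also have "\<dots> = (t\<^sup>2 / 6 * L n) / real n"
      unfolding L_def t2 by simp
    finally have 1: "cmod (char (\<nu> n) ?t - complex_of_real (1 - ?t\<^sup>2 * s n / 2))
        \<le> (t\<^sup>2 / 6 * L n) / real n" by simp
    have "complex_of_real (1 - ?t\<^sup>2 * s n / 2) - z n
        = complex_of_real (t\<^sup>2 / 2 * (v - s n) / real n)"
      unfolding z_def t2 of_real_diff[symmetric] using n by (simp add: field_simps)
    then have 2: "cmod (complex_of_real (1 - ?t\<^sup>2 * s n / 2) - z n) = (t\<^sup>2 / 2 * \<bar>s n - v\<bar>) / real n"
      using n by (simp only: norm_of_real) (simp add: abs_mult abs_minus_commute)
    have "cmod (z n) \<le> 1"
      unfolding z_def norm_of_real using n v elim by (intro abs_leI) (auto simp: field_simps)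
    then have "cmod (char (\<nu> n) ?t ^ n - z n ^ n) \<le> real n * cmod (char (\<nu> n) ?t - z n)"
      by (intro norm_power_diff N.cmod_char_le_1)
    also have "\<dots> \<le> real n * ((t\<^sup>2 / 6 * L n) / real n + (t\<^sup>2 / 2 * \<bar>s n - v\<bar>) / real n)"
      using norm_triangle_le[OF add_mono[OF 1 eq_refl[OF 2]]] by (intro mult_left_mono) auto
    also have "\<dots> = t\<^sup>2 / 6 * L n + t\<^sup>2 / 2 * \<bar>s n - v\<bar>"
      using n by (simp add: field_simps)
    finally show ?case .
  qed
  have "(\<lambda>n. t\<^sup>2 / 6 * L n + t\<^sup>2 / 2 * \<bar>s n - v\<bar>) \<longlonglongrightarrow> t\<^sup>2 / 6 * 0 + t\<^sup>2 / 2 * \<bar>v - v\<bar>"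
    unfolding L_def s_def by (intro tendsto_intros trunc var) auto
  then have "(\<lambda>n. char (\<nu> n) (t / sqrt (real n)) ^ n - z n ^ n) \<longlonglongrightarrow> 0"
    by (intro Lim_null_comparison[OF main]) simp
  moreover have "(\<lambda>n. z n ^ n) \<longlonglongrightarrow> complex_of_real (exp (- (v * t\<^sup>2) / 2))"
    unfolding z_def of_real_power[symmetric]
    by (intro tendsto_of_real tendsto_exp_limit_sequentially)
  ultimately show ?thesis
    using tendsto_add by fastforce
qed

lemma centred_normal_char:
  assumes "0 \<le> v"
  shows "real_distribution (centred_normal v)"
    and "char (centred_normal v) t = complex_of_real (exp (- (v * t\<^sup>2) / 2))"
proof -
  have *: "real_distribution (centred_normal v) \<and>
    char (centred_normal v) t = complex_of_real (exp (- (v * t\<^sup>2) / 2))"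
  proof (cases "v = 0")
    case True
    have "prob_space (return borel (0::real))" by (rule prob_space_return) simp
    then have "real_distribution (return borel (0::real))"
      by (intro real_distribution.intro) (auto simp: real_distribution_axioms_def)
    then show ?thesis
      using True by (simp add: centred_normal_def char_def integral_return)
  next
    case False
    then have v: "0 < sqrt v" using assms by simp
    have eq: "centred_normal v = distr std_normal_distribution borel (\<lambda>x. sqrt v * x)"
    proof -
      interpret S: prob_space std_normal_distribution
        using prob_space_normal_density[of 1 0] by simp
      have "distributed std_normal_distribution lborel (\<lambda>x. x) std_normal_density"
        by (auto simp: distributed_def distr_id2)
      from S.normal_density_affine[OF this _ v[THEN less_imp_neq, symmetric], of 0]
      have "distributed std_normal_distribution lborel (\<lambda>x. sqrt v * x)
          (\<lambda>x. ennreal (normal_density 0 (sqrt v) x))"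
        using v by simp
      then have "distr std_normal_distribution lborel (\<lambda>x. sqrt v * x)
          = density lborel (\<lambda>x. ennreal (normal_density 0 (sqrt v) x))"
        by (simp add: distributed_def)
      moreover have "distr std_normal_distribution lborel (\<lambda>x. sqrt v * x)
          = distr std_normal_distribution borel (\<lambda>x. sqrt v * x)"
        by (intro distr_cong) auto
      ultimately show ?thesis using False by (simp add: centred_normal_def)
    qed
    interpret S: real_distribution std_normal_distribution by (rule real_dist_normal_dist)
    have "char (centred_normal v) t = char std_normal_distribution (sqrt v * t)"
      unfolding eq char_def by (subst integral_distr) (auto simp: mult_ac)
    also have "\<dots> = complex_of_real (exp (- (v * t\<^sup>2) / 2))"
      using assms by (simp add: char_std_normal_distribution power_mult_distrib)
    finally show ?thesis
      unfolding eq using S.real_distribution_distr[of "\<lambda>x. sqrt v * x"] by simp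
  qed
  then show "real_distribution (centred_normal v)"
    and "char (centred_normal v) t = complex_of_real (exp (- (v * t\<^sup>2) / 2))" by auto
qed

lemma weak_conv_m_eventually_cong:
  assumes "\<forall>\<^sub>F n in sequentially. M n = N n"
    and "weak_conv_m M L"
  shows "weak_conv_m N L"
proof -
  have "(\<lambda>n. cdf (M n) x) \<longlonglongrightarrow> l \<longleftrightarrow> (\<lambda>n. cdf (N n) x) \<longlonglongrightarrow> l" for x l
    using assms(1) by (intro tendsto_cong) (auto elim: eventually_mono)
  then show ?thesis using assms(2) by (simp add: weak_conv_m_def weak_conv_def)
qed

text \<open>The central limit theorem for such arrays. Each row may live on its own probability space,
  and finitely many rows may fail to be independent or to have the law \<open>\<nu> n\<close>.\<close>

lemma weak_conv_iid_rows:
  fixes M :: "nat \<Rightarrow> 'w measure" and Y :: "nat \<Rightarrow> nat \<Rightarrow> 'w \<Rightarrow> real" and \<nu> :: "nat \<Rightarrow> real measure"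
  assumes prob: "\<And>n. prob_space (M n)"
    and rows: "\<forall>\<^sub>F n in sequentially. prob_space.indep_vars (M n) (\<lambda>_. borel) (Y n) {1..n} \<and>
        (\<forall>i\<in>{1..n}. distr (M n) borel (Y n i) = \<nu> n)"
    and real: "\<And>n. real_distribution (\<nu> n)"
    and int: "\<forall>\<^sub>F n in sequentially. integrable (\<nu> n) (\<lambda>x. x\<^sup>2)"
    and mean: "\<forall>\<^sub>F n in sequentially. (\<integral>x. x \<partial>\<nu> n) = 0"
    and var: "(\<lambda>n. \<integral>x. x\<^sup>2 \<partial>\<nu> n) \<longlonglongrightarrow> v"
    and trunc: "\<And>c. 0 \<le> c \<Longrightarrow>
      (\<lambda>n. \<integral>x. min (6 * x\<^sup>2) (c / sqrt (real n) * \<bar>x\<bar> ^ 3) \<partial>\<nu> n) \<longlonglongrightarrow> 0"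
  shows "weak_conv_m (\<lambda>n. distr (M n) borel (\<lambda>\<omega>. (\<Sum>i=1..n. Y n i \<omega>) / sqrt (real n)))
    (centred_normal v)"
proof -
  let ?D = "\<lambda>n. distr (M n) borel (\<lambda>\<omega>. (\<Sum>i=1..n. Y n i \<omega>) / sqrt (real n))"
  define good where "good n \<longleftrightarrow> prob_space.indep_vars (M n) (\<lambda>_. borel) (Y n) {1..n} \<and>
        (\<forall>i\<in>{1..n}. distr (M n) borel (Y n i) = \<nu> n)" for n
  have good: "\<forall>\<^sub>F n in sequentially. good n" unfolding good_def by (rule rows)
  have v: "0 \<le> v" using var by (rule LIMSEQ_le_const) auto
  \<comment> \<open>Levy's theorem asks for probability laws at every index, so \<open>D\<close> replaces the irregular rows.\<close>
  define D where "D n = (if good n then ?D n else \<nu> n)" for n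
  have row: "real_distribution (?D n)" "char (?D n) t = char (\<nu> n) (t / sqrt (real n)) ^ n"
    if "good n" for n t
  proof -
    interpret prob_space "M n" by (rule prob)
    have ind: "indep_vars (\<lambda>_. borel) (Y n) {1..n}"
      and d: "\<And>i. i \<in> {1..n} \<Longrightarrow> distr (M n) borel (Y n i) = \<nu> n"
      using that by (auto simp: good_def)
    have rv [measurable]: "\<And>i. i \<in> {1..n} \<Longrightarrow> random_variable borel (Y n i)"
      using ind by (auto simp: indep_vars_def2)
    have sum_rv: "(\<lambda>\<omega>. \<Sum>i=1..n. Y n i \<omega>) \<in> borel_measurable (M n)"
      by (intro borel_measurable_sum rv)
    then show "real_distribution (?D n)" by (intro real_distribution_distr) measurable
    have "char (?D n) t = char (distr (M n) borel (\<lambda>\<omega>. \<Sum>i=1..n. Y n i \<omega>)) (t / sqrt (real n))"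
      unfolding char_def using sum_rv by (simp add: integral_distr)
    also have "\<dots> = (\<Prod>i=1..n. char (distr (M n) borel (Y n i)) (t / sqrt (real n)))"
      by (rule char_distr_sum[OF ind])
    also have "\<dots> = char (\<nu> n) (t / sqrt (real n)) ^ n"
      using d by simp
    finally show "char (?D n) t = char (\<nu> n) (t / sqrt (real n)) ^ n" .
  qed
  have "weak_conv_m D (centred_normal v)"
  proof (rule levy_continuity)
    show "real_distribution (D n)" for n
      using row(1)[of n] real by (simp add: D_def)
    show "real_distribution (centred_normal v)" by (rule centred_normal_char(1)[OF v])
    show "(\<lambda>n. char (D n) t) \<longlonglongrightarrow> char (centred_normal v) t" for t
      unfolding centred_normal_char(2)[OF v]
    proof (rule Lim_transform_eventually)
      show "(\<lambda>n. char (\<nu> n) (t / sqrt (real n)) ^ n) \<longlonglongrightarrow> complex_of_real (exp (- (v * t\<^sup>2) / 2))"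
        by (rule char_power_tendsto_gaussian[OF real int mean var trunc])
      show "\<forall>\<^sub>F n in sequentially. char (\<nu> n) (t / sqrt (real n)) ^ n = char (D n) t"
        using good
      proof eventually_elim
        case (elim n)
        then have "D n = ?D n" by (simp add: D_def)
        then show ?case by (simp only: row(2)[OF elim])
      qed
    qed
  qed
  moreover have "\<forall>\<^sub>F n in sequentially. D n = ?D n"
    using good by eventually_elim (simp add: D_def)
  ultimately show ?thesis by (rule weak_conv_m_eventually_cong[rotated])
qed

section \<open>Regularity of the mean estimator\<close>

text \<open>A bound on the density ratio transfers bounds on integrals from \<open>P_p\<close> to the laws on
  a path, with a constant that is the same for all of them.\<close>

lemma integral_chisq_mix_le:
  assumes w: "second_moment_weights p" "second_moment_weights r"
    and C: "\<And>x. mix_density r x \<le> C * mix_density p x"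
    and g [measurable]: "g \<in> borel_measurable borel" and nn: "\<And>x. 0 \<le> g x"
    and int: "integrable (chisq_mix p) g"
  shows "(\<integral>x. g x \<partial>chisq_mix r) \<le> C * (\<integral>x. g x \<partial>chisq_mix p)"
proof -
  have r: "0 \<le> mix_density r x" for x
    using second_moment_weightsD[OF w(2)] by (intro mix_density_nonneg) auto
  have "(\<integral>x. mix_density r x * g x \<partial>lborel) \<le> (\<integral>x. C * (mix_density p x * g x) \<partial>lborel)"
  proof (rule integral_mono')
    show "integrable lborel (\<lambda>x. C * (mix_density p x * g x))"
      using int by (simp add: integral_chisq_mix(2)[OF w(1) g])
    show le: "mix_density r x * g x \<le> C * (mix_density p x * g x)" for x
      using C[of x] nn[of x] by (simp add: mult_right_mono flip: mult.assoc)
    show "0 \<le> C * (mix_density p x * g x)" for x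
      using le[of x] mult_nonneg_nonneg[OF r nn, of x x] by linarith
  qed
  then show ?thesis
    by (simp add: integral_chisq_mix(1)[OF w(1) g] integral_chisq_mix(1)[OF w(2) g])
qed

text \<open>Although the law changes with \<open>n\<close>, all these laws have densities at most \<open>C\<close> times that of
  \<open>P_p\<close>. So dominated convergence under the single law \<open>P_p\<close> suffices; the second moment of \<open>P_p\<close>
  provides the integrable bound.\<close>

lemma truncated_moment_tendsto_0:
  assumes w: "second_moment_weights p" "\<And>n. second_moment_weights (r n)"
    and C: "\<And>n x. mix_density (r n) x \<le> C * mix_density p x"
    and b: "b \<longlonglongrightarrow> \<beta>" and c: "0 \<le> c"
  shows "(\<lambda>n. \<integral>x. min (6 * (x / 2 - b n)\<^sup>2) (c / sqrt (real n) * \<bar>x / 2 - b n\<bar> ^ 3) \<partial>chisq_mix (r n))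
      \<longlonglongrightarrow> 0"
proof -
  let ?g = "\<lambda>n x. min (6 * (x / 2 - b n)\<^sup>2) (c / sqrt (real n) * \<bar>x / 2 - b n\<bar> ^ 3)"
  have nn: "0 \<le> ?g n x" for n x using c by simp
  interpret P: prob_space "chisq_mix p" by (rule prob_space_weights[OF w(1)])
  obtain K where K: "\<bar>b n\<bar> \<le> K" for n
    using b convergent_imp_Bseq[of b] by (auto simp: convergent_def Bseq_def)
  have int_w: "integrable (chisq_mix p) (\<lambda>x. 3 * x\<^sup>2 + 12 * K\<^sup>2)"
    using chisq_mix_second_moment[OF w(1)] by (auto simp: has_bochner_integral_iff)
  have bound: "norm (?g n x) \<le> 3 * x\<^sup>2 + 12 * K\<^sup>2" for n x
  proof -
    have "(x / 2 - b n)\<^sup>2 \<le> 2 * (x / 2)\<^sup>2 + 2 * (b n)\<^sup>2" by (rule square_diff_le)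
    moreover have "(b n)\<^sup>2 \<le> K\<^sup>2"
      using power_mono[OF K[of n] abs_ge_zero, of 2] by simp
    moreover have "norm (?g n x) \<le> 6 * (x / 2 - b n)\<^sup>2" using nn[where n = n and x = x] by simp
    ultimately show ?thesis by (simp add: power_divide)
  qed
  have int: "integrable (chisq_mix p) (?g n)" for n
    by (rule Bochner_Integration.integrable_bound[OF int_w])
       (use bound in \<open>auto intro!: AE_I2 order_trans[OF bound]\<close>)
  have "(\<lambda>n. \<integral>x. ?g n x \<partial>chisq_mix p) \<longlonglongrightarrow> (\<integral>x. 0 \<partial>chisq_mix p)"
  proof (rule integral_dominated_convergence[OF _ _ int_w])
    show "AE x in chisq_mix p. (\<lambda>n. ?g n x) \<longlonglongrightarrow> 0"
    proof (rule AE_I2)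
      fix x
      have "(\<lambda>n. c / sqrt (real n)) \<longlonglongrightarrow> 0"
        by (intro tendsto_divide_0[OF tendsto_const] filterlim_at_top_imp_at_infinity
            filterlim_compose[OF sqrt_at_top filterlim_real_sequentially])
      then have "(\<lambda>n. ?g n x) \<longlonglongrightarrow> min (6 * (x / 2 - \<beta>)\<^sup>2) (0 * \<bar>x / 2 - \<beta>\<bar> ^ 3)"
        by (intro tendsto_intros b)
      then show "(\<lambda>n. ?g n x) \<longlonglongrightarrow> 0" by simp
    qed
  qed (use bound in auto)
  then have lim: "(\<lambda>n. C * (\<integral>x. ?g n x \<partial>chisq_mix p)) \<longlonglongrightarrow> 0"
    using tendsto_mult_right_zero by fastforce
  have upper: "(\<integral>x. ?g n x \<partial>chisq_mix (r n)) \<le> C * (\<integral>x. ?g n x \<partial>chisq_mix p)" for n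
    by (rule integral_chisq_mix_le[OF w C _ nn int]) measurable
  have lower: "0 \<le> (\<integral>x. ?g n x \<partial>chisq_mix (r n))" for n
    using nn by (intro integral_nonneg_AE AE_I2)
  show ?thesis
    by (rule tendsto_sandwich[OF always_eventually[OF allI[OF lower]]
        always_eventually[OF allI[OF upper]] tendsto_const lim])
qed

text \<open>On the path at \<open>1/\<surd>n\<close> the centred and scaled estimator is the normalised sum of the variables
  \<open>X/2 - b n\<close>, where \<open>b n\<close> is the exact mean of \<open>X/2\<close> under that law. The variance is continuous along
  the path, so its limit is the variance at \<open>P_p\<close>.\<close>

lemma mean_estimator_regular:
  fixes M :: "nat \<Rightarrow> 'w measure" and X :: "nat \<Rightarrow> nat \<Rightarrow> 'w \<Rightarrow> real"
  assumes p: "mixing_seq p" and q: "finite_pmf q" and a: "0 \<le> a"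
    and prob: "\<And>n. prob_space (M n)"
    and rows: "\<forall>\<^sub>F n in sequentially. prob_space.indep_vars (M n) (\<lambda>_. borel) (X n) {1..n} \<and>
        (\<forall>i\<in>{1..n}. distr (M n) borel (X n i) = mix_path p q a (1 / sqrt (real n)))"
  shows "weak_conv_m
      (\<lambda>n. distr (M n) borel (\<lambda>\<omega>. sqrt (real n) *
         (mean_estimator n (\<lambda>i. X n i \<omega>) - kappa (mix_path p q a (1 / sqrt (real n))))))
      (centred_normal (\<integral>x. (influence p x)\<^sup>2 \<partial>chisq_mix p))"
proof -
  note w = second_moment_weights_mixing_seq[OF p] second_moment_weights_finite_pmf[OF q]
  \<comment> \<open>For small \<open>n\<close> the point \<open>1/\<surd>n\<close> may lie beyond the end of the path; the value \<open>0\<close> keeps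
    \<open>r n\<close> a mixing sequence for every \<open>n\<close>.\<close>
  define \<tau> where "\<tau> n = (if a / sqrt (real n) < 1 then a / sqrt (real n) else 0)" for n :: nat
  define r where "r n k = p k + \<tau> n * (q k - p k)" for n k
  define b where "b n = weights_mean (r n) + 1 / 2" for n
  define \<nu> where "\<nu> n = distr (chisq_mix (r n)) borel (\<lambda>x. x / 2 - b n)" for n
  have \<tau>: "0 \<le> \<tau> n" "\<tau> n < 1" for n using a by (auto simp: \<tau>_def)
  have lim0: "(\<lambda>n. a / sqrt (real n)) \<longlonglongrightarrow> 0"
    by (intro tendsto_divide_0[OF tendsto_const] filterlim_at_top_imp_at_infinity
        filterlim_compose[OF sqrt_at_top filterlim_real_sequentially])
  then have small: "\<forall>\<^sub>F n in sequentially. a / sqrt (real n) < 1"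
    by (rule order_tendstoD) simp
  have \<tau>0: "\<tau> \<longlonglongrightarrow> 0"
    by (rule Lim_transform_eventually[OF lim0]) (use small in eventually_elim, simp add: \<tau>_def)
  have wr: "second_moment_weights (r n)" for n
    unfolding r_def[abs_def]
    using mixing_seq_path[OF p q, of "\<tau> n" 1] \<tau>[of n] by (intro second_moment_weights_mixing_seq) simp
  obtain C where C: "1 \<le> C" "\<And>x. mix_density q x \<le> C * mix_density p x"
    using mix_density_ratio_bounded[OF p q] by blast
  have Cr: "mix_density (r n) x \<le> C * mix_density p x" for n x
  proof -
    have "0 \<le> mix_density p x"
      using second_moment_weightsD[OF w(1)] by (intro mix_density_nonneg) auto
    then have "(1 - \<tau> n) * mix_density p x + \<tau> n * mix_density q x
        \<le> (1 - \<tau> n) * (C * mix_density p x) + \<tau> n * (C * mix_density p x)"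
      using \<tau>[of n] C mult_right_mono[of 1 C "mix_density p x"] by (intro add_mono mult_left_mono) auto
    then show ?thesis
      unfolding r_def[abs_def] mix_density_path[OF mixing_seq_Bseq[OF p] finite_pmf_Bseq[OF q]]
      by (simp add: algebra_simps)
  qed
  have m: "weights_mean (r n) = weights_mean p + \<tau> n * (weights_mean q - weights_mean p)"
    and S: "mix_second_moment (r n)
        = mix_second_moment p + \<tau> n * (mix_second_moment q - mix_second_moment p)" for n
    unfolding r_def[abs_def] by (rule weights_mean_path mix_second_moment_path, rule w, rule w)+
  have m_lim: "(\<lambda>n. weights_mean (r n))
      \<longlonglongrightarrow> weights_mean p + 0 * (weights_mean q - weights_mean p)"
    unfolding m by (intro tendsto_intros \<tau>0)
  then have b_lim: "b \<longlonglongrightarrow> weights_mean p + 1 / 2"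
    unfolding b_def[abs_def] by (intro tendsto_intros) simp
  have \<nu>_int: "(\<integral>x. g x \<partial>\<nu> n) = (\<integral>x. g (x / 2 - b n) \<partial>chisq_mix (r n))"
    and \<nu>_integrable: "integrable (\<nu> n) g \<longleftrightarrow> integrable (chisq_mix (r n)) (\<lambda>x. g (x / 2 - b n))"
    if [measurable]: "g \<in> borel_measurable borel" for g :: "real \<Rightarrow> real" and n
    unfolding \<nu>_def by (simp_all add: integral_distr integrable_distr_eq)
  have \<nu>_real: "real_distribution (\<nu> n)" for n
    unfolding \<nu>_def
    by (intro prob_space.real_distribution_distr prob_space_weights wr) simp
  define Y where "Y n i \<omega> = X n i \<omega> / 2 - b n" for n i \<omega>
  have "weak_conv_m (\<lambda>n. distr (M n) borel (\<lambda>\<omega>. (\<Sum>i=1..n. Y n i \<omega>) / sqrt (real n)))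
      (centred_normal (\<integral>x. (influence p x)\<^sup>2 \<partial>chisq_mix p))"
  proof (rule weak_conv_iid_rows[OF prob _ \<nu>_real])
    show "\<forall>\<^sub>F n in sequentially. prob_space.indep_vars (M n) (\<lambda>_. borel) (Y n) {1..n} \<and>
        (\<forall>i\<in>{1..n}. distr (M n) borel (Y n i) = \<nu> n)"
      using rows small
    proof eventually_elim
      case (elim n)
      interpret prob_space "M n" by (rule prob)
      have ind: "indep_vars (\<lambda>_. borel) (X n) {1..n}" using elim by simp
      have "mix_path p q a (1 / sqrt (real n)) = chisq_mix (r n)"
        using mix_path_eq(1)[OF p q a, of "1 / sqrt (real n)"] elim by (simp add: r_def[abs_def] \<tau>_def)
      then have "distr (M n) borel (Y n i) = \<nu> n" if "i \<in> {1..n}" for i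
      proof -
        have [measurable]: "random_variable borel (X n i)"
          using ind that by (auto simp: indep_vars_def2)
        have "distr (distr (M n) borel (X n i)) borel (\<lambda>x. x / 2 - b n) = distr (M n) borel (Y n i)"
          by (subst distr_distr) (auto simp: comp_def Y_def[abs_def])
        then show ?thesis
          using elim that \<open>mix_path p q a (1 / sqrt (real n)) = chisq_mix (r n)\<close> by (simp add: \<nu>_def)
      qed
      moreover have "indep_vars (\<lambda>_. borel) (Y n) {1..n}"
        unfolding Y_def[abs_def] by (rule indep_vars_compose2[OF ind]) auto
      ultimately show ?case by blast
    qed
    show "\<forall>\<^sub>F n in sequentially. integrable (\<nu> n) (\<lambda>x. x\<^sup>2)"
      using centred_half_moments(2)[OF wr] by (simp add: \<nu>_integrable has_bochner_integral_iff)
    show "\<forall>\<^sub>F n in sequentially. (\<integral>x. x \<partial>\<nu> n) = 0"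
      using centred_half_moments(1)[OF wr] by (simp add: \<nu>_int has_bochner_integral_iff b_def)
    have "(\<lambda>n. mix_second_moment (r n) / 4 - b n * (2 * weights_mean (r n) + 1) + (b n)\<^sup>2)
        \<longlonglongrightarrow> (mix_second_moment p + 0 * (mix_second_moment q - mix_second_moment p)) / 4
          - (weights_mean p + 1 / 2)
            * (2 * (weights_mean p + 0 * (weights_mean q - weights_mean p)) + 1)
          + (weights_mean p + 1 / 2)\<^sup>2"
      unfolding S by (intro tendsto_intros \<tau>0 b_lim m_lim) simp
    then show "(\<lambda>n. \<integral>x. x\<^sup>2 \<partial>\<nu> n) \<longlonglongrightarrow> (\<integral>x. (influence p x)\<^sup>2 \<partial>chisq_mix p)"
      using centred_half_moments(2)[OF wr] centred_half_moments(2)[OF w(1), of "weights_mean p + 1 / 2"]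
      by (simp add: \<nu>_int has_bochner_integral_iff influence_def)
    show "(\<lambda>n. \<integral>x. min (6 * x\<^sup>2) (c / sqrt (real n) * \<bar>x\<bar> ^ 3) \<partial>\<nu> n) \<longlonglongrightarrow> 0" if "0 \<le> c" for c
      using truncated_moment_tendsto_0[OF w(1) wr Cr b_lim that] by (simp add: \<nu>_int)
  qed
  moreover have "\<forall>\<^sub>F n in sequentially.
      distr (M n) borel (\<lambda>\<omega>. (\<Sum>i=1..n. Y n i \<omega>) / sqrt (real n))
      = distr (M n) borel (\<lambda>\<omega>. sqrt (real n) *
         (mean_estimator n (\<lambda>i. X n i \<omega>) - kappa (mix_path p q a (1 / sqrt (real n)))))"
    using small eventually_gt_at_top[of 0]
  proof eventually_elim
    case (elim n)
    \<comment> \<open>The mean of \<open>X\<close> is \<open>2\<kappa> + 1\<close>, so \<open>b n = \<kappa> + 1/2\<close> at the current law.\<close>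
    have k: "kappa (mix_path p q a (1 / sqrt (real n))) = b n - 1 / 2"
      using kappa_mix_path[OF p q a, of "1 / sqrt (real n)"] elim by (simp add: b_def m \<tau>_def)
    have "(\<Sum>i=1..n. Y n i \<omega>) / sqrt (real n)
        = sqrt (real n) * (mean_estimator n (\<lambda>i. X n i \<omega>) - (b n - 1 / 2))" for \<omega>
    proof -
      let ?S = "\<Sum>i=1..n. X n i \<omega>"
      have s: "sqrt (real n) * sqrt (real n) = real n" "0 < sqrt (real n)" using elim by simp_all
      have "(\<Sum>i=1..n. Y n i \<omega>) = ?S / 2 - real n * b n"
        by (simp add: Y_def sum_subtractf sum_divide_distrib)
      also have "\<dots> = real n * (mean_estimator n (\<lambda>i. X n i \<omega>) - (b n - 1 / 2))"
        unfolding mean_estimator_def using elim by (simp add: field_simps)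
      also have "\<dots> = (sqrt (real n) * sqrt (real n)) * (mean_estimator n (\<lambda>i. X n i \<omega>) - (b n - 1 / 2))"
        by (simp only: s(1))
      finally have eq: "(\<Sum>i=1..n. Y n i \<omega>)
          = sqrt (real n) * (sqrt (real n) * (mean_estimator n (\<lambda>i. X n i \<omega>) - (b n - 1 / 2)))"
        by (simp only: mult.assoc)
      show ?thesis
        unfolding eq using s(2) by (intro nonzero_mult_div_cancel_left) simp
    qed
    then show ?case unfolding k by simp
  qed
  ultimately show ?thesis by (rule weak_conv_m_eventually_cong[rotated])
qed

theorem theorem14:
  assumes "mixing_seq p"
  shows "asymptotically_efficient TYPE('w) kappa p mean_estimator"
  unfolding asymptotically_efficient_def regular_with_limit_def
  using efficient_influence_kappa[OF assms] mean_estimator_regular[OF assms]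
  by (intro exI[of _ "influence p"]) blast

end
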